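(* Let $(R,\mathfrak m)$ be a zero-dimensional Gorenstein local ring and let $I\subseteq\mathfrak m$ be an ideal. Assume $I^r\ne0$ and $I^{r+1}=0$. Let $G=G(I)=\bigoplus_{i=0}^r G_i$ with $G_i=I^i/I^{i+1}$, and let $S=\operatorname{Soc}(G)=\bigoplus_{i=0}^r S_i$ be the socle of $G$ (annihilator of the unique maximal homogeneous ideal of $G$). The following are equivalent: (1) $G$ is a Gorenstein ring; (2) $S_i=0$ for $0\le i\le r-1$; (3) $0:_R I^{r-i}=I^{i+1}$ for $0\le i\le r-1$; (4) $0:_R I^{r-i}=I^{i+1}$ for $0\le i\le\lfloor\frac{r-1}{2}\rfloor$; (5) $\lambda(G_i)=\lambda(G_{r-i})$ for $0\le i\le\lfloor\frac{r-1}{2}\rfloor$; (6) $I^r:_R I^{r-i}=I^i$ for $1\le i\le r-1$, and $0:_R I=I^r$; (7) $I^{r-i}/I^r$ is a faithful module over $R/I^i$ for $1\le i\le r-1$, and $I$ is faithful over $R/I^r$.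
   Context: $\lambda$ denotes length; $\lfloor x\rfloor$ is the largest integer $\le x$; $G(I)$ is the associated graded ring of $I$. *)

theory Defs
  imports Complex_Main "HOL-Algebra.Ideal_Product" "HOL-Algebra.Ring_Divisibility"
begin

fun ideal_pow :: "('a, 'b) ring_scheme \<Rightarrow> 'a set \<Rightarrow> nat \<Rightarrow> 'a set" where
  "ideal_pow R I 0 = carrier R"
| "ideal_pow R I (Suc n) = ideal_prod R I (ideal_pow R I n)"

definition colon :: "('a, 'b) ring_scheme \<Rightarrow> 'a set \<Rightarrow> 'a set \<Rightarrow> 'a set" where
  "colon R J K = {x \<in> carrier R. \<forall>y\<in>K. x \<otimes>\<^bsub>R\<^esub> y \<in> J}"

definition local_cring :: "('a, 'b) ring_scheme \<Rightarrow> bool" where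
  "local_cring R \<longleftrightarrow> cring R \<and> (\<exists>!m. maximalideal m R)"

definition max_ideal :: "('a, 'b) ring_scheme \<Rightarrow> 'a set" where
  "max_ideal R = (THE m. maximalideal m R)"

definition zero_dim_local_ring :: "('a, 'b) ring_scheme \<Rightarrow> bool" where
  "zero_dim_local_ring R \<longleftrightarrow> local_cring R \<and> noetherian_ring R
      \<and> (\<forall>P. primeideal P R \<longrightarrow> maximalideal P R)"

definition socle :: "('a, 'b) ring_scheme \<Rightarrow> 'a set" where
  "socle R = {x \<in> carrier R. \<forall>y\<in>max_ideal R. x \<otimes>\<^bsub>R\<^esub> y = \<zero>\<^bsub>R\<^esub>}"

text \<open>A zero-dimensional local ring is Gorenstein iff its socle (a vector space over
  the residue field, being killed by m) has dimension 1, i.e. it is nonzero and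
  generated by one element.\<close>
definition gorenstein_zero_dim :: "('a, 'b) ring_scheme \<Rightarrow> bool" where
  "gorenstein_zero_dim R \<longleftrightarrow> zero_dim_local_ring R \<and> socle R \<noteq> {\<zero>\<^bsub>R\<^esub>}
      \<and> (\<exists>s\<in>carrier R. socle R = {a \<otimes>\<^bsub>R\<^esub> s | a. a \<in> carrier R})"

text \<open>Length of the R-module M/N for ideals N \<subseteq> M: the supremum of lengths of strict
  chains of R-submodules between N and M (these are the ideals J with N \<subseteq> J \<subseteq> M).\<close>
definition quot_length :: "('a, 'b) ring_scheme \<Rightarrow> 'a set \<Rightarrow> 'a set \<Rightarrow> nat" where
  "quot_length R M N = Sup {n. \<exists>c. c 0 = N \<and> c n = M \<and> (\<forall>k\<le>n. ideal (c k) R)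
                                  \<and> (\<forall>k<n. c k \<subset> c (Suc k))}"

text \<open>The R/A-module M/N (with A*M \<subseteq> N) is faithful: its annihilator in R/A is zero.\<close>
definition faithful_over :: "('a, 'b) ring_scheme \<Rightarrow> 'a set \<Rightarrow> 'a set \<Rightarrow> 'a set \<Rightarrow> bool" where
  "faithful_over R A M N \<longleftrightarrow> (\<forall>x\<in>carrier R. (\<forall>y\<in>M. x \<otimes>\<^bsub>R\<^esub> y \<in> N) \<longrightarrow> x \<in> A)"

text \<open>An element of G(I) = \<Oplus>_i I^i/I^(i+1) is a finitely supported function sending i to
  a coset a + I^(i+1) with a \<in> I^i.\<close>
definition gr_rep :: "('a, 'b) ring_scheme \<Rightarrow> 'a set \<Rightarrow> nat \<Rightarrow> 'a set \<Rightarrow> 'a" where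
  "gr_rep R I i X = (SOME a. a \<in> ideal_pow R I i \<and> X = ideal_pow R I (Suc i) +>\<^bsub>R\<^esub> a)"

definition gr_carrier :: "('a, 'b) ring_scheme \<Rightarrow> 'a set \<Rightarrow> (nat \<Rightarrow> 'a set) set" where
  "gr_carrier R I = {f. (\<forall>i. \<exists>a\<in>ideal_pow R I i. f i = ideal_pow R I (Suc i) +>\<^bsub>R\<^esub> a)
                     \<and> finite {i. f i \<noteq> ideal_pow R I (Suc i)}}"

definition gr_mult :: "('a, 'b) ring_scheme \<Rightarrow> 'a set \<Rightarrow> (nat \<Rightarrow> 'a set) \<Rightarrow> (nat \<Rightarrow> 'a set) \<Rightarrow> (nat \<Rightarrow> 'a set)" where
  "gr_mult R I f g = (\<lambda>k. ideal_pow R I (Suc k) +>\<^bsub>R\<^esub>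
       (\<Oplus>\<^bsub>R\<^esub>i\<in>{..k}. gr_rep R I i (f i) \<otimes>\<^bsub>R\<^esub> gr_rep R I (k - i) (g (k - i))))"

definition gr_one :: "('a, 'b) ring_scheme \<Rightarrow> 'a set \<Rightarrow> (nat \<Rightarrow> 'a set)" where
  "gr_one R I = (\<lambda>k. if k = 0 then ideal_pow R I 1 +>\<^bsub>R\<^esub> \<one>\<^bsub>R\<^esub> else ideal_pow R I (Suc k))"

definition gr_zero :: "('a, 'b) ring_scheme \<Rightarrow> 'a set \<Rightarrow> (nat \<Rightarrow> 'a set)" where
  "gr_zero R I = (\<lambda>k. ideal_pow R I (Suc k))"

definition gr_add :: "('a, 'b) ring_scheme \<Rightarrow> 'a set \<Rightarrow> (nat \<Rightarrow> 'a set) \<Rightarrow> (nat \<Rightarrow> 'a set) \<Rightarrow> (nat \<Rightarrow> 'a set)" where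
  "gr_add R I f g = (\<lambda>k. ideal_pow R I (Suc k) +>\<^bsub>R\<^esub> (gr_rep R I k (f k) \<oplus>\<^bsub>R\<^esub> gr_rep R I k (g k)))"

definition assoc_graded :: "('a, 'b) ring_scheme \<Rightarrow> 'a set \<Rightarrow> (nat \<Rightarrow> 'a set) ring" where
  "assoc_graded R I = \<lparr> carrier = gr_carrier R I, monoid.mult = gr_mult R I, one = gr_one R I,
                         zero = gr_zero R I, add = gr_add R I \<rparr>"

definition gr_comp :: "('a, 'b) ring_scheme \<Rightarrow> 'a set \<Rightarrow> (nat \<Rightarrow> 'a set) \<Rightarrow> nat \<Rightarrow> (nat \<Rightarrow> 'a set)" where
  "gr_comp R I f i = (\<lambda>j. if j = i then f i else ideal_pow R I (Suc j))"

definition homogeneous_ideal :: "('a, 'b) ring_scheme \<Rightarrow> 'a set \<Rightarrow> (nat \<Rightarrow> 'a set) set \<Rightarrow> bool" where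
  "homogeneous_ideal R I J \<longleftrightarrow> ideal J (assoc_graded R I)
      \<and> (\<forall>f\<in>J. \<forall>i. gr_comp R I f i \<in> J)"

definition gr_max_homog :: "('a, 'b) ring_scheme \<Rightarrow> 'a set \<Rightarrow> (nat \<Rightarrow> 'a set) set" where
  "gr_max_homog R I = (THE J. homogeneous_ideal R I J \<and> J \<noteq> carrier (assoc_graded R I)
      \<and> (\<forall>J'. homogeneous_ideal R I J' \<and> J' \<noteq> carrier (assoc_graded R I) \<and> J \<subseteq> J' \<longrightarrow> J' = J))"

definition gr_socle :: "('a, 'b) ring_scheme \<Rightarrow> 'a set \<Rightarrow> (nat \<Rightarrow> 'a set) set" where
  "gr_socle R I = {x \<in> carrier (assoc_graded R I).
       \<forall>y\<in>gr_max_homog R I. x \<otimes>\<^bsub>assoc_graded R I\<^esub> y = \<zero>\<^bsub>assoc_graded R I\<^esub>}"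

definition gr_socle_deg :: "('a, 'b) ring_scheme \<Rightarrow> 'a set \<Rightarrow> nat \<Rightarrow> (nat \<Rightarrow> 'a set) set" where
  "gr_socle_deg R I i = {f \<in> gr_socle R I. \<forall>j. j \<noteq> i \<longrightarrow> f j = ideal_pow R I (Suc j)}"

end

theory Submission
  imports Defs "HOL-Algebra.UnivPoly" "HOL-Algebra.Subrings"
begin

text \<open>
  In a zero-dimensional Gorenstein local ring the annihilator map \<open>J \<mapsto> 0 : J\<close> is an
  inclusion-reversing involution on ideals with \<open>\<lambda>(0 : J) = \<lambda>(R) - \<lambda>(J)\<close>: each simple step
  \<open>J \<subset> J + (x)\<close> shrinks the annihilator by length at most one, because the quotient embeds
  into the simple socle, and over a composition series all these bounds must be equalities.
  Hence (3) for the index \<open>i\<close> is dual to (3) for \<open>r - 1 - i\<close>, which gives (4), and comparing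
  lengths gives (5); (6) and (7) are reformulations via \<open>(0 : I) : I\<^sup>k = 0 : I\<^sup>k\<^sup>+\<^sup>1\<close>.
  The socle of \<open>G\<close> is graded, and its component of degree \<open>r\<close> is \<open>Soc R\<close>, a line. So it is
  generated by one element iff the other components vanish. They vanish iff every nonzero class in
  \<open>I\<^sup>i / I\<^sup>i\<^sup>+\<^sup>1\<close> can be multiplied into a nonzero element of \<open>I\<^sup>r\<close> by an element of \<open>I\<^sup>r\<^sup>-\<^sup>i\<close>, which is (3).
\<close>

section \<open>Length in zero-dimensional local rings\<close>

no_notation Sum_Type.Plus (infixr "<+>" 65)

text \<open>Two obstacles come from the definitions. \<open>quot_length\<close> is a supremum of
  chain lengths, so additivity, and the fact that a simple step adds exactly one, must be earned by
  a counting argument of Jordan-Hoelder type. And \<open>gorenstein_zero_dim G\<close> asks for more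
  than a principal nonzero socle: \<open>G\<close>, a record whose operations act on cosets through
  chosen representatives, must be shown to be a commutative Noetherian ring with a single prime.
  Most of the ideal theory rests on \<open>ex_socle_mod\<close>: for ideals, a nonzero
  \<open>M / N\<close> has a nonzero element killed by the maximal ideal. It yields composition
  series, refines chains, places proper ideals inside \<open>\<mm>\<close>, and drives the induction
  by which vanishing low socle components give (3). Condition (5) on half of the degrees suffices
  because its equalities telescope to
  \<open>len (Ip 0) - len (Ip (Suc i)) = len (Ip (r - i))\<close> for
  \<open>2 * i + 1 \<le> r\<close>; by duality \<open>ann (Ip (r - i))\<close> then has the length
  of the ideal \<open>Ip (Suc i)\<close> that it contains.\<close>

lemma (in ring) ideal_minus_closed:
  "ideal J R \<Longrightarrow> x \<in> J \<Longrightarrow> y \<in> J \<Longrightarrow> x \<ominus> y \<in> J"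
  unfolding a_minus_def
  by (meson additive_subgroup.a_closed additive_subgroup.a_inv_closed ideal.axioms(1))

lemma (in ring) ideal_subset: "ideal J R \<Longrightarrow> x \<in> J \<Longrightarrow> x \<in> carrier R"
  by (meson additive_subgroup.a_Hcarr ideal.axioms(1))

lemma (in ring) ideal_add: "ideal J R \<Longrightarrow> x \<in> J \<Longrightarrow> y \<in> J \<Longrightarrow> x \<oplus> y \<in> J"
  by (meson additive_subgroup.a_closed ideal.axioms(1))

lemma (in ring) ideal_zero: "ideal J R \<Longrightarrow> \<zero> \<in> J"
  by (meson additive_subgroup.zero_closed ideal.axioms(1))

lemma (in ring) ideal_mem_add_iff:
  assumes "ideal J R" "x \<in> carrier R" "y \<in> J" shows "x \<oplus> y \<in> J \<longleftrightarrow> x \<in> J"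
proof
  assume "x \<oplus> y \<in> J"
  then have "(x \<oplus> y) \<ominus> y \<in> J" using assms ideal_minus_closed by blast
  moreover have "(x \<oplus> y) \<ominus> y = x"
    using assms ideal_subset by (simp add: a_minus_def a_assoc r_neg)
  ultimately show "x \<in> J" by simp
qed (use assms ideal_add in blast)

lemma (in cring) idealI':
  assumes "J \<subseteq> carrier R" "\<zero> \<in> J" "\<And>x y. x \<in> J \<Longrightarrow> y \<in> J \<Longrightarrow> x \<oplus> y \<in> J"
    "\<And>x a. x \<in> J \<Longrightarrow> a \<in> carrier R \<Longrightarrow> x \<otimes> a \<in> J"
  shows "ideal J R"
proof (rule idealI)
  show "subgroup J (add_monoid R)"
  proof (rule add.subgroupI)
    show "\<ominus> a \<in> J" if "a \<in> J" for a
      using assms(4)[OF that, of "\<ominus> \<one>"] that assms(1) by (auto simp: r_minus)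
  qed (use assms in auto)
  show "x \<otimes> a \<in> J" if "a \<in> J" "x \<in> carrier R" for a x
    using assms(4)[OF that] that assms(1) by (metis m_comm subsetD)
qed (use assms ring_axioms in auto)

lemma (in cring) colon_ideal:
  assumes "ideal J R" "K \<subseteq> carrier R" shows "ideal (colon R J K) R"
proof (rule idealI')
  fix x a assume x: "x \<in> colon R J K" and a: "a \<in> carrier R"
  show "x \<otimes> a \<in> colon R J K" unfolding colon_def
  proof (intro CollectI conjI ballI)
    fix y assume y: "y \<in> K"
    have "x \<otimes> a \<otimes> y = (x \<otimes> y) \<otimes> a" using x y a assms(2)
      by (auto simp: colon_def m_ac subset_eq)
    then show "x \<otimes> a \<otimes> y \<in> J" using x y a by (auto simp: colon_def ideal.I_r_closed[OF assms(1)])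
  qed (use x a in \<open>auto simp: colon_def\<close>)
qed (use assms ideal_zero ideal_add in \<open>auto simp: colon_def l_distr subset_eq\<close>)

lemma (in cring) mem_add_cgenideal:
  "y \<in> J <+> PIdl x \<longleftrightarrow> (\<exists>j\<in>J. \<exists>a\<in>carrier R. y = j \<oplus> a \<otimes> x)"
  by (auto simp: set_add_def' cgenideal_def)

lemma (in cring) add_cgenideal_ideal:
  "ideal J R \<Longrightarrow> x \<in> carrier R \<Longrightarrow> ideal (J <+> PIdl x) R"
  by (simp add: add_ideals cgenideal_ideal)

lemma (in cring) add_cgenideal_subset:
  assumes "ideal J R" "ideal K R" "J \<subseteq> K" "x \<in> K" shows "J <+> PIdl x \<subseteq> K"
proof
  fix y assume "y \<in> J <+> PIdl x"
  then obtain j a where "j \<in> J" "a \<in> carrier R" "y = j \<oplus> a \<otimes> x"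
    by (auto simp: mem_add_cgenideal)
  then show "y \<in> K" using assms ideal_add[OF assms(2)] ideal.I_l_closed[OF assms(2,4)] by blast
qed

lemma (in cring) subset_add_cgenideal:
  assumes "ideal J R" "x \<in> carrier R" shows "J \<subseteq> J <+> PIdl x" "x \<in> J <+> PIdl x"
proof
  show "y \<in> J <+> PIdl x" if "y \<in> J" for y
    unfolding mem_add_cgenideal using assms that ideal_subset
    by (intro bexI[of _ y] bexI[of _ \<zero>]) auto
  show "x \<in> J <+> PIdl x"
    unfolding mem_add_cgenideal using assms ideal_zero
    by (intro bexI[of _ \<zero>] bexI[of _ \<one>]) auto
qed

text \<open>In a Noetherian ring the union of a nonempty chain of ideals is a member of the chain,
  so every chain in the family is bounded inside the family and Zorn's lemma applies.\<close>

lemma (in noetherian_ring) ex_maximal_ideal_in: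
  assumes "\<C> \<noteq> {}" "\<And>J. J \<in> \<C> \<Longrightarrow> ideal J R"
  shows "\<exists>M\<in>\<C>. \<forall>X\<in>\<C>. M \<subseteq> X \<longrightarrow> X = M"
proof (rule subset_Zorn_nonempty[OF assms(1)])
  fix C assume "C \<noteq> {}" and C: "subset.chain \<C> C"
  then have "subset.chain {J. ideal J R} C"
    using assms(2) by (auto simp: pred_on.chain_def)
  then have "\<Union>C \<in> C" using \<open>C \<noteq> {}\<close> ideal_chain_is_trivial by blast
  then show "\<Union>C \<in> \<C>" using C by (auto simp: pred_on.chain_def)
qed

text \<open>A locale, because the facts proved here for \<open>R\<close> are used again for the
  associated graded ring once that is known to be zero-dimensional local.\<close>

locale zero_dim_local = cring +
  assumes zdl: "zero_dim_local_ring R"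
begin


abbreviation "\<mm> \<equiv> max_ideal R"

lemma maximalideal_max_ideal: "maximalideal \<mm> R"
  unfolding max_ideal_def by (rule theI') (use zdl in \<open>simp add: zero_dim_local_ring_def local_cring_def\<close>)

lemma ideal_max_ideal: "ideal \<mm> R"
  using maximalideal_max_ideal maximalideal.axioms(1) by blast

lemma max_ideal_subset: "y \<in> \<mm> \<Longrightarrow> y \<in> carrier R"
  using ideal_subset ideal_max_ideal by blast

lemma primeideal_eq_max_ideal: "primeideal P R \<Longrightarrow> P = \<mm>"
  using zdl maximalideal_max_ideal unfolding zero_dim_local_ring_def local_cring_def by blast

lemma noetherian: "noetherian_ring R"
  using zdl by (simp add: zero_dim_local_ring_def)

text \<open>The annihilator of an element of \<open>M / N\<close> that is maximal among such annihilators is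
  prime, hence equal to the maximal ideal.\<close>
lemma ex_socle_mod:
  assumes N: "ideal N R" and M: "ideal M R" and "\<not> M \<subseteq> N"
  shows "\<exists>x\<in>M - N. \<forall>y\<in>\<mm>. x \<otimes> y \<in> N"
proof -
  define \<C> where "\<C> = (\<lambda>x. colon R N {x}) ` (M - N)"
  have MR: "x \<in> carrier R" if "x \<in> M" for x using M that ideal_subset by blast
  have "\<C> \<noteq> {}" using assms by (auto simp: \<C>_def)
  moreover have "ideal J R" if "J \<in> \<C>" for J
    using that colon_ideal[OF N] MR by (auto simp: \<C>_def)
  ultimately obtain P where P: "P \<in> \<C>" "\<forall>X\<in>\<C>. P \<subseteq> X \<longrightarrow> X = P"
    using noetherian_ring.ex_maximal_ideal_in[OF noetherian] by metis
  then obtain x where x: "x \<in> M - N" "P = colon R N {x}" by (auto simp: \<C>_def)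
  have xR: "x \<in> carrier R" using x MR by simp
  have iP: "ideal P R" using colon_ideal[OF N] xR x by simp
  have "primeideal P R"
  proof (rule primeidealI[OF iP is_cring])
    have "\<one> \<notin> P" using x xR by (auto simp: colon_def)
    then show "carrier R \<noteq> P" by auto
    fix a b assume ab: "a \<in> carrier R" "b \<in> carrier R" "a \<otimes> b \<in> P"
    show "a \<in> P \<or> b \<in> P"
    proof (rule disjCI)
      assume "b \<notin> P"
      then have bx: "b \<otimes> x \<in> M - N"
        using ab x ideal.I_l_closed[OF M] by (auto simp: colon_def)
      have "P \<subseteq> colon R N {b \<otimes> x}"
      proof
        fix p assume p: "p \<in> P"
        then have pR: "p \<in> carrier R" using iP ideal_subset by blast
        have "p \<otimes> (b \<otimes> x) = b \<otimes> (p \<otimes> x)" using pR xR ab by (simp add: m_lcomm)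
        moreover have "p \<otimes> x \<in> N" using p x by (simp add: colon_def)
        ultimately show "p \<in> colon R N {b \<otimes> x}"
          using ideal.I_l_closed[OF N] ab pR by (simp add: colon_def)
      qed
      then have "colon R N {b \<otimes> x} = P" using P(2) bx by (auto simp: \<C>_def)
      moreover have "a \<otimes> (b \<otimes> x) \<in> N" using ab x xR by (simp add: colon_def m_assoc)
      ultimately show "a \<in> P" using ab by (auto simp: colon_def)
    qed
  qed
  then have "P = \<mm>" by (rule primeideal_eq_max_ideal)
  then have "x \<otimes> y \<in> N" if y: "y \<in> \<mm>" for y
    using y x m_comm[OF xR max_ideal_subset[OF y]] by (auto simp: colon_def)
  then show ?thesis using x by blast
qed

text \<open>An \<open>x\<close> outside \<open>J\<close> with \<open>x \<mm> \<subseteq> J\<close>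
  rules out \<open>J + \<mm> = R\<close>, since \<open>1 = j + u\<close> would put
  \<open>x = x j + x u\<close> into \<open>J\<close>. Maximality of \<open>\<mm>\<close> then forces
  \<open>J + \<mm> = \<mm>\<close>.\<close>

lemma proper_ideal_subset_max_ideal:
  assumes J: "ideal J R" and "J \<noteq> carrier R"
  shows "J \<subseteq> \<mm>"
proof -
  have "\<not> carrier R \<subseteq> J" using assms ideal_subset by blast
  then obtain x where x: "x \<in> carrier R - J" "\<forall>y\<in>\<mm>. x \<otimes> y \<in> J"
    using ex_socle_mod[OF J oneideal] by blast
  let ?K = "J <+> \<mm>"
  have sub: "J \<subseteq> ?K" "\<mm> \<subseteq> ?K"
    using ideal_zero[OF J] ideal_zero[OF ideal_max_ideal] ideal_subset[OF J] max_ideal_subset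
    by (force simp: set_add_def')+
  have K: "ideal ?K R" using add_ideals J ideal_max_ideal by blast
  have "\<one> \<notin> ?K"
  proof
    assume "\<one> \<in> ?K"
    then obtain j u where ju: "j \<in> J" "u \<in> \<mm>" "\<one> = j \<oplus> u" by (auto simp: set_add_def')
    then have c: "j \<in> carrier R" "u \<in> carrier R" using ideal_subset[OF J] max_ideal_subset by auto
    have "x = x \<otimes> \<one>" using x by simp
    also have "\<dots> = x \<otimes> j \<oplus> x \<otimes> u" using x c ju(3) by (simp add: r_distr)
    also have "\<dots> \<in> J" using ideal_add[OF J] ideal.I_l_closed[OF J ju(1)] x ju by auto
    finally show False using x by simp
  qed
  then have "?K \<noteq> carrier R" by auto
  then have "?K = \<mm>"
    using maximalideal.I_maximal[OF maximalideal_max_ideal K sub(2)] ideal_subset[OF K] by blast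
  then show ?thesis using sub by auto
qed

lemma unit_if_notin_max_ideal:
  assumes "a \<in> carrier R" "a \<notin> \<mm>" shows "\<exists>b\<in>carrier R. b \<otimes> a = \<one>"
proof -
  have "PIdl a = carrier R"
    using proper_ideal_subset_max_ideal[OF cgenideal_ideal] cgenideal_self assms by blast
  then have "\<one> \<in> PIdl a" by simp
  then obtain b where "b \<in> carrier R" "\<one> = b \<otimes> a" by (auto simp: cgenideal_def)
  then show ?thesis by metis
qed

lemma one_notin_max_ideal: "\<one> \<notin> \<mm>"
  using maximalideal.I_notcarr[OF maximalideal_max_ideal] ideal.one_imp_carrier[OF ideal_max_ideal]
  by blast

text \<open>\<open>(J + (x)) / J\<close> is a quotient of the residue field, so each nonzero element
  generates it: the coefficient of \<open>x\<close> in \<open>y\<close> avoids \<open>\<mm>\<close>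
  and is a unit.\<close>

lemma add_cgenideal_cover:
  assumes J: "ideal J R" and x: "x \<in> carrier R" "\<forall>y\<in>\<mm>. x \<otimes> y \<in> J"
    and y: "y \<in> J <+> PIdl x" "y \<notin> J" and z: "z \<in> J <+> PIdl x"
  shows "\<exists>u\<in>carrier R. \<exists>j\<in>J. z = j \<oplus> u \<otimes> y"
proof -
  obtain j a where ja: "j \<in> J" "a \<in> carrier R" "y = j \<oplus> a \<otimes> x"
    using y(1) by (auto simp: mem_add_cgenideal)
  obtain k c where kc: "k \<in> J" "c \<in> carrier R" "z = k \<oplus> c \<otimes> x"
    using z by (auto simp: mem_add_cgenideal)
  have jk: "j \<in> carrier R" "k \<in> carrier R" using ideal_subset[OF J] ja kc by auto
  have "a \<notin> \<mm>"
  proof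
    assume "a \<in> \<mm>"
    then have "a \<otimes> x \<in> J" using x ja by (metis m_comm)
    then show False using ja y(2) ideal_add[OF J] by blast
  qed
  then obtain b where b: "b \<in> carrier R" "b \<otimes> a = \<one>"
    using unit_if_notin_max_ideal ja by blast
  have "c \<otimes> x = c \<otimes> ((b \<otimes> a) \<otimes> x)" using b kc x by simp
  also have "\<dots> = (c \<otimes> b) \<otimes> (a \<otimes> x)" using b(1) kc ja x by (simp add: m_assoc)
  finally have cx: "c \<otimes> x = (c \<otimes> b) \<otimes> (a \<otimes> x)" .
  have "z = (k \<ominus> (c \<otimes> b) \<otimes> j) \<oplus> (c \<otimes> b) \<otimes> y"
    unfolding kc(3) cx ja(3) using b(1) kc(2) ja(2) x(1) jk by algebra
  moreover have "k \<ominus> (c \<otimes> b) \<otimes> j \<in> J"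
    using ideal_minus_closed[OF J] ideal.I_l_closed[OF J ja(1)] kc b by simp
  ultimately show ?thesis using kc b by blast
qed

text \<open>Among the ideals reachable from zero by adjoining socle elements modulo the previous
  ideal, take a maximal one; were it proper, \<open>ex_socle_mod\<close> would prolong its
  series.\<close>

lemma ex_composition_series:
  obtains n N X where "N 0 = {\<zero>}" "N n = carrier R" "\<And>i. i \<le> n \<Longrightarrow> ideal (N i) R"
    "\<And>i. i < n \<Longrightarrow> X i \<in> carrier R" "\<And>i y. i < n \<Longrightarrow> y \<in> \<mm> \<Longrightarrow> X i \<otimes> y \<in> N i"
    "\<And>i. i < n \<Longrightarrow> N (Suc i) = N i <+> PIdl (X i)"
proof -
  define ser where "ser n N X \<longleftrightarrow> N 0 = {\<zero>} \<and> (\<forall>i\<le>n. ideal (N i) R) \<and>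
    (\<forall>i<n. X i \<in> carrier R \<and> (\<forall>y\<in>\<mm>. X i \<otimes> y \<in> N i) \<and> N (Suc i) = N i <+> PIdl (X i))"
    for n :: nat and N X
  define \<C> where "\<C> = {J. ideal J R \<and> (\<exists>n N X. ser n N X \<and> N n = J)}"
  have "ser 0 (\<lambda>_. {\<zero>}) (\<lambda>_. \<zero>)" by (simp add: ser_def zeroideal)
  then have "\<exists>n N X. ser n N X \<and> N n = {\<zero>}" by (intro exI conjI) auto
  then have "{\<zero>} \<in> \<C>" using zeroideal by (simp add: \<C>_def)
  then have "\<C> \<noteq> {}" by blast
  moreover have "ideal J R" if "J \<in> \<C>" for J using that by (simp add: \<C>_def)
  ultimately have "\<exists>M\<in>\<C>. \<forall>X\<in>\<C>. M \<subseteq> X \<longrightarrow> X = M"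
    by (rule noetherian_ring.ex_maximal_ideal_in[OF noetherian])
  then obtain M where M: "M \<in> \<C>" "\<And>X. X \<in> \<C> \<Longrightarrow> M \<subseteq> X \<Longrightarrow> X = M" by blast
  then obtain n N X where s: "ser n N X" "N n = M" and iM: "ideal M R" by (auto simp: \<C>_def)
  have "M = carrier R"
  proof (rule ccontr)
    assume "M \<noteq> carrier R"
    then obtain x where x: "x \<in> carrier R - M" "\<forall>y\<in>\<mm>. x \<otimes> y \<in> M"
      using ex_socle_mod[OF iM oneideal] ideal_subset[OF iM] by blast
    have iK: "ideal (M <+> PIdl x) R" using add_cgenideal_ideal iM x by blast
    have "ser (Suc n) (N(Suc n := M <+> PIdl x)) (X(n := x))"
      using s x iK by (auto simp: ser_def less_Suc_eq le_Suc_eq)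
    moreover have "(N(Suc n := M <+> PIdl x)) (Suc n) = M <+> PIdl x" by simp
    ultimately have "\<exists>n N X. ser n N X \<and> N n = M <+> PIdl x" by blast
    then have "M <+> PIdl x \<in> \<C>" using iK by (simp add: \<C>_def)
    then have "M <+> PIdl x = M" using M(2) subset_add_cgenideal(1)[OF iM, of x] x by simp
    then show False using subset_add_cgenideal[OF iM, of x] x by blast
  qed
  with s have "N n = carrier R" by simp
  then show thesis by (rule that[rotated]) (use s(1) in \<open>simp_all add: ser_def\<close>)
qed

text \<open>The length of \<open>J\<close> counts the factors of a fixed composition series \<open>N\<close> in which \<open>J\<close>
  has a nonzero image.\<close>
lemma ex_length_function:
  obtains l :: "'a set \<Rightarrow> nat" where "l {\<zero>} = 0"
    "\<And>J K. ideal J R \<Longrightarrow> ideal K R \<Longrightarrow> J \<subset> K \<Longrightarrow> l J < l K"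
    "\<And>J x. ideal J R \<Longrightarrow> x \<in> carrier R - J \<Longrightarrow> \<forall>y\<in>\<mm>. x \<otimes> y \<in> J \<Longrightarrow> l (J <+> PIdl x) = Suc (l J)"
proof -
  obtain n N X where N: "N 0 = {\<zero>}" "N n = carrier R" "\<And>i. i \<le> n \<Longrightarrow> ideal (N i) R"
    "\<And>i. i < n \<Longrightarrow> X i \<in> carrier R" "\<And>i y. i < n \<Longrightarrow> y \<in> \<mm> \<Longrightarrow> X i \<otimes> y \<in> N i"
    "\<And>i. i < n \<Longrightarrow> N (Suc i) = N i <+> PIdl (X i)"
    by (rule ex_composition_series) blast
  define S where "S J = {i. i < n \<and> \<not> J \<inter> N (Suc i) \<subseteq> N i}" for J
  define l where "l J = card (S J)" for J
  have fin: "finite (S J)" for J unfolding S_def by auto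
  have S_mono: "S J \<subseteq> S K" if "J \<subseteq> K" for J K using that by (auto simp: S_def)
  have N_Suc: "N i \<subseteq> N (Suc i)" if "i < n" for i
    using subset_add_cgenideal(1)[OF N(3)[of i] N(4)[of i]] N(6)[of i] that by simp
  have N_mono: "N i \<subseteq> N j" if "i \<le> j" "j \<le> n" for i j
    using that
  proof (induction rule: dec_induct)
    case (step k) then show ?case using N_Suc[of k] by auto
  qed simp
  have cover: "\<exists>u\<in>carrier R. \<exists>j\<in>N i. z = j \<oplus> u \<otimes> y"
    if "i < n" "y \<in> N (Suc i)" "y \<notin> N i" "z \<in> N (Suc i)" for i y z
    by (rule add_cgenideal_cover[of _ "X i"]) (use N that in auto)
  \<comment> \<open>Induction along the series: where \<open>J\<close> and \<open>K\<close> both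
    jump, an element of \<open>K\<close> is a multiple of an element of \<open>J\<close> up to
    something in \<open>K \<inter> N i\<close>, which is already in \<open>J\<close>.\<close>
  have eq: "K \<subseteq> J" if J: "ideal J R" and K: "ideal K R" and JK: "J \<subseteq> K" "S J = S K" for J K
  proof -
    have "K \<inter> N i \<subseteq> J" if "i \<le> n" for i using that
    proof (induction i)
      case 0 then show ?case using N ideal_zero[OF J] by auto
    next
      case (Suc i)
      show ?case
      proof
        fix z assume z: "z \<in> K \<inter> N (Suc i)"
        show "z \<in> J"
        proof (cases "i \<in> S K")
          case False then show ?thesis using Suc z by (auto simp: S_def)
        next
          case True
          then obtain y where y: "y \<in> J" "y \<in> N (Suc i)" "y \<notin> N i" using JK by (auto simp: S_def)
          obtain u j where u: "u \<in> carrier R" "j \<in> N i" "z = j \<oplus> u \<otimes> y"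
            using cover[of i y z] Suc y z by auto
          have uy: "u \<otimes> y \<in> J" using ideal.I_l_closed[OF J] y u by blast
          have "ideal (N i) R" using N Suc by simp
          then have "j \<in> K" using z u uy JK ideal_mem_add_iff[OF K, of j "u \<otimes> y"] ideal_subset by blast
          then have "j \<in> J" using Suc u by auto
          then show ?thesis using u uy ideal_add[OF J] by blast
        qed
      qed
    qed
    from this[of n] show ?thesis using N ideal_subset[OF K] by auto
  qed
  show thesis
  proof (rule that[of l])
    have "S {\<zero>} = {}" using N(3) ideal_zero by (auto simp: S_def)
    then show "l {\<zero>} = 0" by (simp add: l_def)
    fix J assume J: "ideal J R"
    show strict: "l J < l K" if K: "ideal K R" and JK: "J \<subset> K" for K
    proof -
      have "S J \<noteq> S K" using eq[OF J K] JK by blast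
      then show ?thesis unfolding l_def using S_mono[of J K] JK fin psubset_card_mono by blast
    qed
    fix x assume x: "x \<in> carrier R - J" and xm: "\<forall>y\<in>\<mm>. x \<otimes> y \<in> J"
    let ?K = "J <+> PIdl x"
    have K: "ideal ?K R" using add_cgenideal_ideal J x by blast
    have JK: "J \<subset> ?K" using subset_add_cgenideal[OF J, of x] x by auto
    \<comment> \<open>Two new jumps \<open>i < j\<close> are impossible:
      \<open>(J + (x)) / J\<close> is simple, so \<open>b\<close> is a multiple of \<open>a\<close>
      plus some \<open>k\<close> in \<open>J\<close>. As \<open>a\<close> lies in
      \<open>N j\<close>, this \<open>k\<close> lies in \<open>J \<inter> N (Suc j)\<close>, hence
      in \<open>N j\<close>, and so does \<open>b\<close>.\<close>
    have no_two: False if ij: "i \<in> S ?K - S J" "j \<in> S ?K - S J" "i < j" for i j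
    proof -
      obtain a where a: "a \<in> ?K" "a \<in> N (Suc i)" "a \<notin> N i" using ij by (auto simp: S_def)
      obtain b where b: "b \<in> ?K" "b \<in> N (Suc j)" "b \<notin> N j" using ij by (auto simp: S_def)
      have jn: "j < n" using ij by (auto simp: S_def)
      have Ji: "J \<inter> N (Suc i) \<subseteq> N i" and Jj: "J \<inter> N (Suc j) \<subseteq> N j" using ij by (auto simp: S_def)
      then have "a \<notin> J" using a by auto
      then obtain u k where u: "u \<in> carrier R" "k \<in> J" "b = k \<oplus> u \<otimes> a"
        using add_cgenideal_cover[OF J _ xm a(1) _ b(1)] x by blast
      have iNj: "ideal (N j) R" "ideal (N (Suc j)) R" using N(3) jn by auto
      have "a \<in> N j" using N_mono[of "Suc i" j] a ij jn by auto
      then have ua: "u \<otimes> a \<in> N j" using ideal.I_l_closed[OF iNj(1)] u by blast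
      then have "u \<otimes> a \<in> N (Suc j)" using N_Suc[OF jn] by blast
      then have "k \<in> N (Suc j)" using ideal_mem_add_iff[OF iNj(2), of k "u \<otimes> a"] b u ideal_subset[OF J] by blast
      then have "k \<in> N j" using Jj u by auto
      then show False using b u ua ideal_add[OF iNj(1)] by blast
    qed
    have "i = j" if "i \<in> S ?K - S J" "j \<in> S ?K - S J" for i j
      using no_two[of i j] no_two[of j i] that by (meson linorder_neqE_nat)
    then have "card (S ?K - S J) \<le> 1"
      using card_le_Suc0_iff_eq[of "S ?K - S J"] fin[of ?K] by simp
    then have "l ?K \<le> Suc (l J)"
      unfolding l_def using S_mono[of J ?K] JK fin by (simp add: card_Diff_subset less_imp_le)
    then show "l ?K = Suc (l J)" using strict[OF K JK] by linarith
  qed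
qed

text \<open>Strictness of \<open>l\<close> bounds every chain by \<open>l M - l N\<close>. A chain
  of that length arises by repeatedly adjoining a socle element of \<open>M\<close> modulo the
  current ideal, each raising \<open>l\<close> by one. So the supremum in \<open>quot_length\<close>
  is a maximum.\<close>

lemma quot_length_eq:
  fixes l :: "'a set \<Rightarrow> nat"
  assumes strict: "\<And>J K. ideal J R \<Longrightarrow> ideal K R \<Longrightarrow> J \<subset> K \<Longrightarrow> l J < l K"
    and step: "\<And>J x. ideal J R \<Longrightarrow> x \<in> carrier R - J \<Longrightarrow> \<forall>y\<in>\<mm>. x \<otimes> y \<in> J \<Longrightarrow> l (J <+> PIdl x) = Suc (l J)"
    and N: "ideal N R" and M: "ideal M R" and "N \<subseteq> M"
  shows "quot_length R M N = l M - l N"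
proof -
  define chain where "chain n c N \<longleftrightarrow> c 0 = N \<and> c n = M \<and> (\<forall>k\<le>n. ideal (c k) R) \<and> (\<forall>k<n. c k \<subset> c (Suc k))"
    for n :: nat and c N
  have le: "n \<le> l M - l N" if "chain n c N" for n c
  proof -
    have "l N + k \<le> l (c k)" if "k \<le> n" for k using that
    proof (induction k)
      case (Suc k)
      then show ?case using strict[of "c k" "c (Suc k)"] \<open>chain n c N\<close> by (auto simp: chain_def)
    qed (use \<open>chain n c N\<close> in \<open>auto simp: chain_def\<close>)
    from this[of n] show ?thesis using \<open>chain n c N\<close> by (auto simp: chain_def)
  qed
  have ex: "\<exists>c. chain (l M - l N) c N" using N \<open>N \<subseteq> M\<close>
  proof (induction "l M - l N" arbitrary: N)
    case 0
    then have "N = M" using strict[of N M] M by fastforce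
    then show ?case using M by (intro exI[of _ "\<lambda>_. M"]) (auto simp: chain_def)
  next
    case (Suc d)
    then have "\<not> M \<subseteq> N" by auto
    then obtain x where x: "x \<in> M - N" "\<forall>y\<in>\<mm>. x \<otimes> y \<in> N" using ex_socle_mod Suc M by blast
    have xR: "x \<in> carrier R" using x ideal_subset[OF M] by blast
    let ?N = "N <+> PIdl x"
    have N: "ideal N R" "N \<subseteq> M" using Suc by auto
    have iN: "ideal ?N R" by (rule add_cgenideal_ideal[OF N(1) xR])
    have NM: "?N \<subseteq> M" by (rule add_cgenideal_subset) (use N M x in auto)
    have NN: "N \<subset> ?N" using subset_add_cgenideal[OF N(1) xR] x by auto
    have "l ?N = Suc (l N)" using step Suc x xR by blast
    then have d: "d = l M - l ?N" using Suc by simp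
    then obtain c where c: "chain d c ?N" using Suc iN NM by blast
    have "chain (Suc d) (case_nat N c) N"
      using c Suc NN by (auto simp: chain_def split: nat.splits)
    then show ?case using Suc by auto
  qed
  show ?thesis unfolding quot_length_def chain_def[symmetric]
    by (rule cSup_eq_maximum) (use ex le in auto)
qed

abbreviation "len J \<equiv> quot_length R J {\<zero>}"

text \<open>The counting function of \<open>ex_length_function\<close> agrees with
  \<open>len\<close> on ideals, so its properties pass to the length used in the theorem.\<close>

lemma len_zero: "len {\<zero>} = 0"
  and len_strict_mono: "ideal J R \<Longrightarrow> ideal K R \<Longrightarrow> J \<subset> K \<Longrightarrow> len J < len K"
  and len_add_cgenideal: "ideal J R \<Longrightarrow> x \<in> carrier R - J \<Longrightarrow> \<forall>y\<in>\<mm>. x \<otimes> y \<in> J \<Longrightarrow>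
    len (J <+> PIdl x) = Suc (len J)"
  and quot_length_diff: "ideal J R \<Longrightarrow> ideal K R \<Longrightarrow> J \<subseteq> K \<Longrightarrow> quot_length R K J = len K - len J"
proof -
  obtain l :: "'a set \<Rightarrow> nat" where l: "l {\<zero>} = 0"
    "\<And>J K. ideal J R \<Longrightarrow> ideal K R \<Longrightarrow> J \<subset> K \<Longrightarrow> l J < l K"
    "\<And>J x. ideal J R \<Longrightarrow> x \<in> carrier R - J \<Longrightarrow> \<forall>y\<in>\<mm>. x \<otimes> y \<in> J \<Longrightarrow> l (J <+> PIdl x) = Suc (l J)"
    by (rule ex_length_function) blast
  have len: "len J = l J" if "ideal J R" for J
    using quot_length_eq[of l "{\<zero>}" J] l that zeroideal ideal_zero by simp
  show "len {\<zero>} = 0" using len zeroideal l by simp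
  show "ideal J R \<Longrightarrow> ideal K R \<Longrightarrow> J \<subset> K \<Longrightarrow> len J < len K" using len l(2) by simp
  show "ideal J R \<Longrightarrow> x \<in> carrier R - J \<Longrightarrow> \<forall>y\<in>\<mm>. x \<otimes> y \<in> J \<Longrightarrow> len (J <+> PIdl x) = Suc (len J)"
    using len l(3) add_cgenideal_ideal by simp
  show "ideal J R \<Longrightarrow> ideal K R \<Longrightarrow> J \<subseteq> K \<Longrightarrow> quot_length R K J = len K - len J"
    using len quot_length_eq[of l J K] l by simp
qed

lemma len_mono: "ideal J R \<Longrightarrow> ideal K R \<Longrightarrow> J \<subseteq> K \<Longrightarrow> len J \<le> len K"
  using len_strict_mono by (metis less_imp_le order_refl psubsetI)

lemma ideal_eq_if_len_le:
  "ideal J R \<Longrightarrow> ideal K R \<Longrightarrow> J \<subseteq> K \<Longrightarrow> len K \<le> len J \<Longrightarrow> J = K"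
  using len_strict_mono by (metis not_less psubsetI)

end

section \<open>Colons by products, and powers of an ideal\<close>

context cring
begin

text \<open>Testing against products of elements is enough, where \<open>x (a b) = (x b) a\<close>;
  sums follow because \<open>N\<close> is an ideal. This is the source of
  \<open>(0 : I) : I\<^sup>k = 0 : I\<^sup>k\<^sup>+\<^sup>1\<close>.\<close>

lemma colon_ideal_prod:
  assumes N: "ideal N R" and I: "ideal I R" and J: "ideal J R"
  shows "colon R N (ideal_prod R I J) = colon R (colon R N I) J"
proof
  note c = ideal_subset[OF I] ideal_subset[OF J]
  show "colon R N (ideal_prod R I J) \<subseteq> colon R (colon R N I) J"
  proof
    fix x assume x: "x \<in> colon R N (ideal_prod R I J)"
    have "x \<otimes> b \<otimes> a \<in> N" if "a \<in> I" "b \<in> J" for a b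
    proof -
      have "x \<otimes> b \<otimes> a = x \<otimes> (a \<otimes> b)" using x c that by (simp add: colon_def m_ac)
      then show ?thesis using x ideal_prod.prod[OF that, of R] by (simp add: colon_def)
    qed
    then show "x \<in> colon R (colon R N I) J" using x c by (auto simp: colon_def)
  qed
  show "colon R (colon R N I) J \<subseteq> colon R N (ideal_prod R I J)"
  proof
    fix x assume x: "x \<in> colon R (colon R N I) J"
    then have xR: "x \<in> carrier R" by (simp add: colon_def)
    have "x \<otimes> s \<in> N" if "s \<in> ideal_prod R I J" for s using that
    proof induction
      case (prod a b)
      have "x \<otimes> (a \<otimes> b) = x \<otimes> b \<otimes> a" using xR c prod by (simp add: m_ac)
      then show ?case using x prod by (simp add: colon_def)
    next
      case (sum s t)
      then have "s \<in> carrier R" "t \<in> carrier R" using ideal_prod_in_carrier[OF I J] by auto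
      then show ?case using sum xR ideal_add[OF N] by (simp add: r_distr)
    qed
    then show "x \<in> colon R N (ideal_prod R I J)" using xR by (simp add: colon_def)
  qed
qed

context
  fixes I assumes I: "ideal I R"
begin

lemma ideal_pow_ideal: "ideal (ideal_pow R I i) R"
  by (induction i) (use I oneideal ideal_prod_is_ideal in auto)

lemma ideal_pow_carrier: "a \<in> ideal_pow R I i \<Longrightarrow> a \<in> carrier R"
  using ideal_subset[OF ideal_pow_ideal] .

lemma ideal_pow_Suc_0: "ideal_pow R I (Suc 0) = I"
  using ideal_prod_one[OF I] by simp

lemma ideal_pow_mult:
  assumes "a \<in> ideal_pow R I i" "b \<in> ideal_pow R I j"
  shows "a \<otimes> b \<in> ideal_pow R I (i + j)"
  using assms(1)
proof (induction i arbitrary: a)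
  case 0
  then show ?case using ideal.I_l_closed[OF ideal_pow_ideal assms(2)] by simp
next
  case (Suc i)
  have b: "b \<in> carrier R" using ideal_pow_carrier assms(2) .
  from Suc.prems have "a \<in> ideal_prod R I (ideal_pow R I i)" by simp
  then have "a \<otimes> b \<in> ideal_prod R I (ideal_pow R I (i + j))"
  proof induction
    case (prod x y)
    have "x \<otimes> y \<otimes> b = x \<otimes> (y \<otimes> b)"
      using prod b ideal_subset[OF I] ideal_pow_carrier by (simp add: m_assoc)
    then show ?case using prod Suc.IH by (auto intro: ideal_prod.prod)
  next
    case (sum x y)
    then have "x \<in> carrier R" "y \<in> carrier R"
      using ideal_prod_in_carrier[OF I ideal_pow_ideal] by auto
    then show ?case using sum b by (auto simp: l_distr intro: ideal_prod.sum)
  qed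
  then show ?case by simp
qed

lemma ideal_pow_Suc_subset: "ideal_pow R I (Suc i) \<subseteq> ideal_pow R I i"
  using ideal_prod_inter[OF I ideal_pow_ideal] by auto

lemma ideal_pow_antimono: "i \<le> j \<Longrightarrow> ideal_pow R I j \<subseteq> ideal_pow R I i"
  by (induction rule: dec_induct) (use ideal_pow_Suc_subset in auto)

end

end

section \<open>Duality in Gorenstein rings\<close>

locale gorenstein_local = zero_dim_local +
  assumes gor: "gorenstein_zero_dim R"
begin

abbreviation "ann J \<equiv> colon R {\<zero>} J"

lemma ann_ideal: "ideal J R \<Longrightarrow> ideal (ann J) R"
  by (intro colon_ideal zeroideal) (use ideal_subset in auto)

text \<open>If \<open>s\<close> generates the socle and \<open>a = c s\<close> is nonzero, then
  \<open>c\<close> avoids \<open>\<mm>\<close>, because \<open>\<mm>\<close> kills \<open>s\<close>;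
  so \<open>c\<close> is a unit and \<open>a\<close> generates the socle too.\<close>

lemma socle_multiple:
  assumes "a \<in> socle R" "a \<noteq> \<zero>" "b \<in> socle R" shows "\<exists>u\<in>carrier R. b = u \<otimes> a"
proof -
  obtain s where s: "s \<in> carrier R" "socle R = {a \<otimes> s | a. a \<in> carrier R}"
    using gor by (auto simp: gorenstein_zero_dim_def)
  then have "\<one> \<otimes> s \<in> socle R" by blast
  then have s': "s \<in> socle R" using s by simp
  obtain c d where cd: "c \<in> carrier R" "a = c \<otimes> s" "d \<in> carrier R" "b = d \<otimes> s"
    using assms(1,3) unfolding s(2) by blast
  have "c \<notin> \<mm>"
  proof
    assume "c \<in> \<mm>"
    then have "s \<otimes> c = \<zero>" using s' by (simp add: socle_def)
    then show False using cd s assms m_comm by simp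
  qed
  then obtain e where e: "e \<in> carrier R" "e \<otimes> c = \<one>" using unit_if_notin_max_ideal cd by blast
  have "d \<otimes> e \<otimes> a = d \<otimes> (e \<otimes> c) \<otimes> s" using cd e(1) s(1) by (simp add: m_assoc)
  also have "\<dots> = b" using cd e s(1) by simp
  finally show ?thesis using e cd by (metis m_closed)
qed

lemma ex_socle_nonzero: obtains z where "z \<in> socle R" "z \<noteq> \<zero>"
proof -
  have "\<zero> \<in> socle R" using max_ideal_subset by (auto simp: socle_def)
  then show thesis using gor that unfolding gorenstein_zero_dim_def by blast
qed

text \<open>A nonzero ideal contains a nonzero socle element, and that one element generates the
  socle. Applied to \<open>I\<^sup>r\<close>, this places the socle of \<open>R\<close> in the top
  degree of \<open>G\<close>.\<close>

lemma socle_subset_nonzero_ideal: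
  assumes J: "ideal J R" and "J \<noteq> {\<zero>}" shows "socle R \<subseteq> J"
proof
  fix z assume z: "z \<in> socle R"
  have "\<not> J \<subseteq> {\<zero>}" using assms ideal_zero by blast
  then obtain x where x: "x \<in> J - {\<zero>}" "\<forall>y\<in>\<mm>. x \<otimes> y \<in> {\<zero>}"
    using ex_socle_mod[OF zeroideal J] by blast
  then have "x \<in> socle R" using ideal_subset[OF J] by (auto simp: socle_def)
  then obtain u where "u \<in> carrier R" "z = u \<otimes> x" using socle_multiple[of x z] z x by auto
  then show "z \<in> J" using ideal.I_l_closed[OF J] x by blast
qed

lemma mem_ann_add_cgenideal:
  assumes J: "ideal J R" and x: "x \<in> carrier R"
  shows "a \<in> ann (J <+> PIdl x) \<longleftrightarrow> a \<in> ann J \<and> a \<otimes> x = \<zero>"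
proof
  assume "a \<in> ann (J <+> PIdl x)"
  then show "a \<in> ann J \<and> a \<otimes> x = \<zero>"
    using subset_add_cgenideal[OF J x] by (auto simp: colon_def)
next
  assume a: "a \<in> ann J \<and> a \<otimes> x = \<zero>"
  then have aR: "a \<in> carrier R" by (simp add: colon_def)
  have "a \<otimes> (j \<oplus> c \<otimes> x) = \<zero>" if "j \<in> J" "c \<in> carrier R" for j c
  proof -
    have "a \<otimes> (j \<oplus> c \<otimes> x) = a \<otimes> j \<oplus> c \<otimes> (a \<otimes> x)"
      using that x aR ideal_subset[OF J] by (simp add: r_distr m_lcomm)
    then show ?thesis using a that by (simp add: colon_def)
  qed
  then show "a \<in> ann (J <+> PIdl x)" using aR by (auto simp: colon_def mem_add_cgenideal)
qed

text \<open>Multiplication by \<open>x\<close> embeds \<open>ann J / ann (J + (x))\<close> into the simple socle.\<close>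
lemma len_ann_step:
  assumes J: "ideal J R" and x: "x \<in> carrier R" "\<forall>y\<in>\<mm>. x \<otimes> y \<in> J"
  shows "len (ann J) \<le> Suc (len (ann (J <+> PIdl x)))"
proof -
  let ?K = "J <+> PIdl x"
  have aJ: "ideal (ann J) R" and aK: "ideal (ann ?K) R"
    using ann_ideal J add_cgenideal_ideal x by auto
  have soc: "a \<otimes> x \<in> socle R" if a: "a \<in> ann J" for a
  proof -
    have aR: "a \<in> carrier R" using a by (simp add: colon_def)
    have "a \<otimes> x \<otimes> y = \<zero>" if "y \<in> \<mm>" for y
      using a that x aR max_ideal_subset by (simp add: m_assoc colon_def)
    then show ?thesis using aR x by (simp add: socle_def)
  qed
  show ?thesis
  proof (cases "ann J \<subseteq> ann ?K")
    case True
    then show ?thesis using len_mono[OF aJ aK] by simp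
  next
    case False
    \<comment> \<open>Modulo \<open>ann ?K\<close> this \<open>b\<close> is killed by
      \<open>\<mm>\<close> and spans \<open>ann J\<close>: for any other \<open>a\<close> the socle
      is a line, so \<open>a x = u (b x)\<close> and \<open>a - u b\<close> kills
      \<open>x\<close>.\<close>
    then obtain b where b: "b \<in> ann J" "b \<otimes> x \<noteq> \<zero>"
      using mem_ann_add_cgenideal[OF J x(1)] by blast
    then have bR: "b \<in> carrier R" by (simp add: colon_def)
    have "b \<otimes> y \<in> ann ?K" if y: "y \<in> \<mm>" for y
    proof -
      have yR: "y \<in> carrier R" using y max_ideal_subset by blast
      have "b \<otimes> y \<otimes> x = b \<otimes> (x \<otimes> y)" using bR x yR by (simp add: m_ac)
      then have "b \<otimes> y \<otimes> x = \<zero>" using b x y by (simp add: colon_def)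
      then show ?thesis
        using mem_ann_add_cgenideal[OF J x(1)] ideal.I_r_closed[OF aJ b(1) yR] by blast
    qed
    moreover have "b \<notin> ann ?K" using b mem_ann_add_cgenideal[OF J x(1)] by blast
    ultimately have len: "len (ann ?K <+> PIdl b) = Suc (len (ann ?K))"
      using len_add_cgenideal[OF aK] bR by blast
    have "ann J \<subseteq> ann ?K <+> PIdl b"
    proof
      fix a assume a: "a \<in> ann J"
      then have aR: "a \<in> carrier R" by (simp add: colon_def)
      obtain u where u: "u \<in> carrier R" "a \<otimes> x = u \<otimes> (b \<otimes> x)"
        using socle_multiple[OF soc[OF b(1)] b(2) soc[OF a]] by blast
      have "(a \<ominus> u \<otimes> b) \<otimes> x = a \<otimes> x \<ominus> u \<otimes> (b \<otimes> x)" using aR u(1) bR x by algebra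
      also have "\<dots> = \<zero>" using u bR x by (simp add: a_minus_def r_neg)
      finally have "a \<ominus> u \<otimes> b \<in> ann ?K"
        using mem_ann_add_cgenideal[OF J x(1)] ideal_minus_closed[OF aJ a ideal.I_l_closed[OF aJ b(1) u(1)]]
        by blast
      moreover have "a = (a \<ominus> u \<otimes> b) \<oplus> u \<otimes> b" using aR u(1) bR by algebra
      ultimately show "a \<in> ann ?K <+> PIdl b" unfolding mem_add_cgenideal using u by blast
    qed
    then show ?thesis
      using len_mono[OF aJ add_cgenideal_ideal[OF aK bR]] len by simp
  qed
qed

text \<open>Along a simple step \<open>len J\<close> grows by exactly one and
  \<open>len (ann J)\<close> falls by at most one, so the sum cannot fall.\<close>

lemma len_ann_mono:
  assumes "ideal J R" "ideal K R" "J \<subseteq> K"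
  shows "len (ann J) + len J \<le> len (ann K) + len K"
  using assms
proof (induction "len K - len J" arbitrary: J rule: less_induct)
  case less
  show ?case
  proof (cases "J = K")
    case False
    then have "\<not> K \<subseteq> J" using less by auto
    then obtain x where x: "x \<in> K - J" "\<forall>y\<in>\<mm>. x \<otimes> y \<in> J"
      using ex_socle_mod less by blast
    have xR: "x \<in> carrier R" using x ideal_subset less by blast
    let ?J = "J <+> PIdl x"
    have iJ: "ideal ?J R" using add_cgenideal_ideal less xR by blast
    have JK: "?J \<subseteq> K" by (rule add_cgenideal_subset) (use less x in auto)
    have l: "len ?J = Suc (len J)" using len_add_cgenideal less x xR by blast
    have "len ?J \<le> len K" using len_mono iJ less JK by blast
    then have "len (ann ?J) + len ?J \<le> len (ann K) + len K"
      using less.hyps[OF _ iJ less(3) JK] l by linarith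
    then show ?thesis using len_ann_step[OF less(2) xR x(2)] l by linarith
  qed simp
qed

text \<open>The sum is monotone in \<open>J\<close> and has the same value at the zero ideal and at
  the whole ring, so it is constant.\<close>

lemma len_ann:
  assumes J: "ideal J R" shows "len (ann J) + len J = len (carrier R)"
proof -
  have "ann {\<zero>} = carrier R" by (auto simp: colon_def)
  then have "len (carrier R) \<le> len (ann J) + len J"
    using len_ann_mono[OF zeroideal J] ideal_zero[OF J] len_zero by simp
  moreover have "ann (carrier R) = {\<zero>}"
  proof
    show "ann (carrier R) \<subseteq> {\<zero>}"
    proof
      fix x assume x: "x \<in> ann (carrier R)"
      then have xR: "x \<in> carrier R" and "x \<otimes> \<one> \<in> {\<zero>}" unfolding colon_def by blast+
      then show "x \<in> {\<zero>}" by simp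
    qed
  qed (auto simp: colon_def)
  then have "len (ann J) + len J \<le> len (carrier R)"
    using len_ann_mono[OF J oneideal] ideal_subset[OF J] len_zero by auto
  ultimately show ?thesis by linarith
qed

text \<open>One inclusion is formal, and two applications of \<open>len_ann\<close> show that both
  ideals have the same length.\<close>

lemma ann_ann:
  assumes J: "ideal J R" shows "ann (ann J) = J"
proof -
  have "J \<subseteq> ann (ann J)"
  proof
    fix x assume x: "x \<in> J"
    have "x \<otimes> y = \<zero>" if "y \<in> ann J" for y
    proof -
      have "x \<otimes> y = y \<otimes> x" using that x ideal_subset[OF J] by (simp add: colon_def m_comm)
      then show ?thesis using that x by (simp add: colon_def)
    qed
    then show "x \<in> ann (ann J)" using x ideal_subset[OF J] by (simp add: colon_def)
  qed
  moreover have "len (ann (ann J)) \<le> len J"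
    using len_ann[OF J] len_ann[OF ann_ideal[OF J]] by linarith
  ultimately show ?thesis
    using ideal_eq_if_len_le[OF J ann_ideal[OF ann_ideal[OF J]]] by simp
qed

end

section \<open>Annihilators of powers\<close>

locale nilpotent_ideal = zero_dim_local +
  fixes I r
  assumes I: "ideal I R" and I_subset: "I \<subseteq> \<mm>" and I_Suc: "ideal_pow R I (Suc r) = {\<zero>}"
begin

abbreviation "Ip \<equiv> ideal_pow R I"

lemmas Ip_ideal = ideal_pow_ideal[OF I]
lemmas Ip_carrier = ideal_pow_carrier[OF I]
lemmas Ip_mult = ideal_pow_mult[OF I]
lemmas Ip_antimono = ideal_pow_antimono[OF I]
lemmas Ip_Suc_0 = ideal_pow_Suc_0[OF I]

lemma Ip_zero: "\<zero> \<in> Ip i"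
  using ideal_zero[OF Ip_ideal] .

lemma Ip_eq_zero: "r < i \<Longrightarrow> Ip i = {\<zero>}"
  using Ip_antimono[of "Suc r" i] I_Suc Ip_zero[of i] by auto

lemma colon_Ip_Ip:
  "ideal N R \<Longrightarrow> colon R (colon R N (Ip (Suc 0))) (Ip k) = colon R N (Ip (Suc k))"
  using colon_ideal_prod[OF _ I Ip_ideal] Ip_Suc_0 by simp

end

declare ideal_pow.simps(2) [simp del]

locale gorenstein_nilpotent = nilpotent_ideal + gorenstein_local +
  assumes I_r: "ideal_pow R I r \<noteq> {\<zero>}"
begin

lemma Ip_subset_ann: "r < i + j \<Longrightarrow> Ip i \<subseteq> ann (Ip j)"
  using Ip_mult[of _ i _ j] Ip_eq_zero[of "i + j"] Ip_carrier by (auto simp: colon_def)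

lemma ann_half_iff:
  "(\<forall>i<r. ann (Ip (r - i)) = Ip (Suc i)) \<longleftrightarrow> (\<forall>i. 2 * i + 1 \<le> r \<longrightarrow> ann (Ip (r - i)) = Ip (Suc i))"
    (is "_ \<longleftrightarrow> ?half")
proof
  assume h: ?half
  show "\<forall>i<r. ann (Ip (r - i)) = Ip (Suc i)"
  proof (intro allI impI)
    fix i assume i: "i < r"
    show "ann (Ip (r - i)) = Ip (Suc i)"
    proof (cases "2 * i + 1 \<le> r")
      case False
      \<comment> \<open>The mirror image of \<open>i\<close>; it falls into the lower half because
        \<open>i\<close> does not.\<close>
      define k where "k = r - Suc i"
      have k: "2 * k + 1 \<le> r" "r - i = Suc k" "r - k = Suc i" using False i by (auto simp: k_def)
      then have "ann (Ip (Suc i)) = Ip (r - i)" using h by metis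
      then show ?thesis using ann_ann[OF Ip_ideal, of "Suc i"] by simp
    qed (use h in blast)
  qed
qed auto

lemma quot_length_Ip: "i \<le> j \<Longrightarrow> quot_length R (Ip i) (Ip j) = len (Ip i) - len (Ip j)"
  using quot_length_diff[OF Ip_ideal Ip_ideal Ip_antimono] .

lemma len_Ip_le: "i \<le> j \<Longrightarrow> len (Ip j) \<le> len (Ip i)"
  using len_mono[OF Ip_ideal Ip_ideal Ip_antimono] .

text \<open>The annihilator identities give
  \<open>len (Ip (Suc r - i)) + len (Ip i) = len (Ip 0)\<close> for all \<open>i \<le> r\<close>;
  subtracting this at \<open>i\<close> and at \<open>i + 1\<close> gives the equalities. The
  converse sums them from degree \<open>0\<close> up to \<open>i\<close>.\<close>

lemma ann_half_iff_length:
  "(\<forall>i. 2 * i + 1 \<le> r \<longrightarrow> ann (Ip (r - i)) = Ip (Suc i)) \<longleftrightarrow>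
   (\<forall>i. 2 * i + 1 \<le> r \<longrightarrow> quot_length R (Ip i) (Ip (Suc i)) = quot_length R (Ip (r - i)) (Ip (Suc (r - i))))"
    (is "?A \<longleftrightarrow> ?L")
proof
  assume h: ?A
  then have full: "ann (Ip (r - i)) = Ip (Suc i)" if "i < r" for i using ann_half_iff that by blast
  let ?n = "len (Ip 0)"
  have n: "len (Ip (Suc r - i)) + len (Ip i) = ?n" if "i \<le> r" for i
  proof (cases i)
    case 0 then show ?thesis using Ip_eq_zero[of "Suc r"] len_zero by simp
  next
    case (Suc k)
    then show ?thesis using full[of k] len_ann[OF Ip_ideal, of "r - k"] that by (simp add: add.commute)
  qed
  show ?L
  proof (intro allI impI)
    fix i assume i: "2 * i + 1 \<le> r"
    have "len (Ip (Suc r - i)) + len (Ip i) = ?n" "len (Ip (Suc r - Suc i)) + len (Ip (Suc i)) = ?n"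
      using n[of i] n[of "Suc i"] i by auto
    moreover have "Suc r - i = Suc (r - i)" using i by simp
    ultimately show "quot_length R (Ip i) (Ip (Suc i)) = quot_length R (Ip (r - i)) (Ip (Suc (r - i)))"
      by (simp only: quot_length_Ip le_SucI order_refl diff_Suc_Suc)
  qed
next
  assume L: ?L
  have sum: "len (Ip 0) - len (Ip (Suc i)) = len (Ip (r - i))" if "2 * i + 1 \<le> r" for i
    using that
  proof (induction i)
    case 0
    have "len (Ip (Suc r)) = 0" using Ip_eq_zero[of "Suc r"] len_zero by simp
    then show ?case
      using L[rule_format, OF 0] quot_length_Ip[of r "Suc r"] quot_length_Ip[of 0 "Suc 0"]
      by simp
  next
    case (Suc i)
    have eq: "len (Ip (Suc i)) - len (Ip (Suc (Suc i))) = len (Ip (r - Suc i)) - len (Ip (Suc (r - Suc i)))"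
      using L[rule_format, of "Suc i"] Suc.prems
        quot_length_Ip[of "Suc i" "Suc (Suc i)"] quot_length_Ip[of "r - Suc i" "Suc (r - Suc i)"]
      by simp
    have "Suc (r - Suc i) = r - i" using Suc.prems by simp
    then have eq: "len (Ip (Suc i)) - len (Ip (Suc (Suc i))) = len (Ip (r - Suc i)) - len (Ip (r - i))"
      using eq by (simp only:)
    have IH: "len (Ip 0) - len (Ip (Suc i)) = len (Ip (r - i))" using Suc by simp
    \<comment> \<open>These inequalities make the truncated subtractions genuine ones.\<close>
    have "len (Ip (Suc i)) \<le> len (Ip 0)" "len (Ip (Suc (Suc i))) \<le> len (Ip (Suc i))"
      "len (Ip (r - i)) \<le> len (Ip (r - Suc i))" by (rule len_Ip_le, simp)+
    then show ?case using eq IH by linarith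
  qed
  show ?A
  proof (intro allI impI)
    fix i assume i: "2 * i + 1 \<le> r"
    have "len (ann (Ip (r - i))) + len (Ip (r - i)) = len (Ip 0)" using len_ann[OF Ip_ideal] by simp
    moreover have "len (Ip (Suc i)) \<le> len (Ip 0)" by (rule len_Ip_le) simp
    ultimately have "len (ann (Ip (r - i))) \<le> len (Ip (Suc i))" using sum[OF i] by linarith
    moreover have "Ip (Suc i) \<subseteq> ann (Ip (r - i))" by (rule Ip_subset_ann) (use i in simp)
    ultimately show "ann (Ip (r - i)) = Ip (Suc i)"
      using ideal_eq_if_len_le[OF Ip_ideal ann_ideal[OF Ip_ideal]] by metis
  qed
qed

text \<open>Given \<open>0 : I = I\<^sup>r\<close>, the colon in (6) at \<open>i\<close> is the
  annihilator in (3) at \<open>i - 1\<close>. The last index \<open>r - 1\<close> of (3) has no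
  partner among these; it is the separate clause \<open>0 : I = I\<^sup>r\<close>.\<close>

lemma ann_iff_colon:
  "(\<forall>i<r. ann (Ip (r - i)) = Ip (Suc i)) \<longleftrightarrow>
   (\<forall>i. 1 \<le> i \<and> i < r \<longrightarrow> colon R (Ip r) (Ip (r - i)) = Ip i) \<and> ann I = Ip r"
    (is "?A \<longleftrightarrow> ?C \<and> ?D")
proof
  assume A: ?A
  have D: ?D
  proof (cases r)
    \<comment> \<open>Here \<open>?A\<close> is empty and says nothing, but \<open>I\<close> is
      zero, so both sides are the whole ring.\<close>
    case 0
    then have "I = {\<zero>}" using I_Suc Ip_Suc_0 by simp
    then show ?thesis using 0 by (auto simp: colon_def)
  next
    case (Suc k)
    then have "ann (Ip (Suc 0)) = Ip r" using A[rule_format, of k] by simp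
    then show ?thesis unfolding Ip_Suc_0 .
  qed
  have C: "colon R (Ip r) (Ip (r - i)) = Ip i" if i: "1 \<le> i" "i < r" for i
  proof -
    have "colon R (Ip r) (Ip (r - i)) = ann (Ip (Suc (r - i)))"
      using D colon_Ip_Ip[OF zeroideal, of "r - i"] Ip_Suc_0 by simp
    also have "Suc (r - i) = r - (i - 1)" using i by simp
    finally show ?thesis using A[rule_format, of "i - 1"] i by simp
  qed
  show "?C \<and> ?D" using C D by blast
next
  assume CD: "?C \<and> ?D"
  show ?A
  proof (intro allI impI)
    fix i assume i: "i < r"
    show "ann (Ip (r - i)) = Ip (Suc i)"
    proof (cases "Suc i = r")
      case True
      then have "r - i = Suc 0" by simp
      then have "ann (Ip (r - i)) = ann I" using Ip_Suc_0 by metis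
      then show ?thesis using CD True by simp
    next
      case False
      then have "r - i = Suc (r - Suc i)" using i by simp
      then have "ann (Ip (r - i)) = colon R (ann (Ip (Suc 0))) (Ip (r - Suc i))"
        using colon_Ip_Ip[OF zeroideal] by metis
      also have "\<dots> = colon R (Ip r) (Ip (r - Suc i))" using CD unfolding Ip_Suc_0 by simp
      finally show ?thesis using CD i False by (metis Suc_lessI le_add1 plus_1_eq_Suc)
    qed
  qed
qed

text \<open>Faithfulness is one inclusion of the colon equality; the other always holds, by
  \<open>I\<^sup>i I\<^sup>r\<^sup>-\<^sup>i \<subseteq> I\<^sup>r\<close> and
  \<open>I\<^sup>r I = 0\<close>.\<close>

lemma colon_iff_faithful:
  "(\<forall>i. 1 \<le> i \<and> i < r \<longrightarrow> colon R (Ip r) (Ip (r - i)) = Ip i) \<and> ann I = Ip r \<longleftrightarrow>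
   (\<forall>i. 1 \<le> i \<and> i < r \<longrightarrow> faithful_over R (Ip i) (Ip (r - i)) (Ip r)) \<and> faithful_over R (Ip r) I {\<zero>}"
proof -
  have faithful: "faithful_over R A M N \<longleftrightarrow> colon R N M \<subseteq> A" for A M N
    by (auto simp: faithful_over_def colon_def)
  have "Ip i \<subseteq> colon R (Ip r) (Ip (r - i))" if "i < r" for i
    using Ip_mult[of _ i _ "r - i"] that Ip_carrier by (auto simp: colon_def)
  moreover have "Ip r \<subseteq> ann I" using Ip_subset_ann[of r "Suc 0"] unfolding Ip_Suc_0 by simp
  ultimately show ?thesis unfolding faithful by blast
qed

end

section \<open>The associated graded ring\<close>

lemma (in ring) ideal_finsum_closed:
  assumes "ideal J R" "\<And>i. i \<in> A \<Longrightarrow> f i \<in> J" shows "finsum R f A \<in> J"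
  using assms(2)
proof (induction A rule: infinite_finite_induct)
  case (insert x A)
  then have "f \<in> insert x A \<rightarrow> carrier R" using ideal_subset[OF assms(1)] by blast
  then show ?case using insert ideal_add[OF assms(1)] by (auto simp: finsum_insert Pi_iff)
qed (use ideal_zero[OF assms(1)] in auto)

lemma (in abelian_group) finsum_minus:
  assumes "f \<in> A \<rightarrow> carrier G" "g \<in> A \<rightarrow> carrier G"
  shows "finsum G f A \<ominus> finsum G g A = (\<Oplus>i\<in>A. f i \<ominus> g i)"
  using assms
proof (induction A rule: infinite_finite_induct)
  case (insert x A)
  then have "finsum G f A \<in> carrier G" "finsum G g A \<in> carrier G" "f x \<in> carrier G" "g x \<in> carrier G"
    by auto
  then show ?case using insert
    by (simp add: finsum_insert Pi_iff a_minus_def minus_add a_ac)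
qed (auto simp: a_minus_def r_neg)

context nilpotent_ideal
begin

text \<open>The polynomials \<open>\<Sum> p\<^sub>i X\<^sup>i\<close> with \<open>p\<^sub>i \<in> I\<^sup>i\<close>; they form a subring of \<open>R[X]\<close>, and \<open>G\<close> gets its
  ring axioms as the image of this subring under \<open>gr_class\<close>. No finiteness condition is
  needed because \<open>I\<close> is nilpotent.\<close>
definition rees :: "(nat \<Rightarrow> 'a) set" where
  "rees = {p. \<forall>i. p i \<in> Ip i}"

definition gr_class :: "(nat \<Rightarrow> 'a) \<Rightarrow> nat \<Rightarrow> 'a set" where
  "gr_class p = (\<lambda>i. Ip (Suc i) +> p i)"

definition single :: "'a \<Rightarrow> nat \<Rightarrow> nat \<Rightarrow> 'a" where
  "single a i = (\<lambda>j. if j = i then a else \<zero>)"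

definition conv :: "(nat \<Rightarrow> 'a) \<Rightarrow> (nat \<Rightarrow> 'a) \<Rightarrow> nat \<Rightarrow> 'a" where
  "conv p q = (\<lambda>k. \<Oplus>i\<in>{..k}. p i \<otimes> q (k - i))"

abbreviation "G \<equiv> assoc_graded R I"

lemma rees_D: "p \<in> rees \<Longrightarrow> p i \<in> Ip i" and rees_carrier: "p \<in> rees \<Longrightarrow> p i \<in> carrier R"
  using Ip_carrier by (auto simp: rees_def)

lemma rees_eq_zero: "p \<in> rees \<Longrightarrow> r < i \<Longrightarrow> p i = \<zero>"
  using Ip_eq_zero rees_D by blast

lemma rees_zero: "(\<lambda>_. \<zero>) \<in> rees" and rees_one: "single \<one> 0 \<in> rees"
  and rees_single: "a \<in> Ip i \<Longrightarrow> single a i \<in> rees"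
  by (auto simp: rees_def single_def Ip_zero)

lemma rees_add: "p \<in> rees \<Longrightarrow> q \<in> rees \<Longrightarrow> (\<lambda>i. p i \<oplus> q i) \<in> rees"
  and rees_minus: "p \<in> rees \<Longrightarrow> q \<in> rees \<Longrightarrow> (\<lambda>i. p i \<ominus> q i) \<in> rees"
  using ideal_add[OF Ip_ideal] ideal_minus_closed[OF Ip_ideal] by (auto simp: rees_def)

lemma conv_term: "p \<in> rees \<Longrightarrow> q \<in> rees \<Longrightarrow> i \<le> k \<Longrightarrow> p i \<otimes> q (k - i) \<in> Ip k"
  using Ip_mult[of "p i" i "q (k - i)" "k - i"] rees_D by simp

lemma rees_conv:
  assumes "p \<in> rees" "q \<in> rees" shows "conv p q \<in> rees"
proof -
  have "conv p q k \<in> Ip k" for k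
    unfolding conv_def by (rule ideal_finsum_closed[OF Ip_ideal]) (use assms conv_term in auto)
  then show ?thesis by (simp add: rees_def)
qed

lemma rees_subset_up: "rees \<subseteq> up R"
proof
  fix p assume "p \<in> rees"
  then show "p \<in> up R" using rees_carrier rees_eq_zero by (intro mem_upI exI[of _ r] bound.intro) auto
qed

lemma subcring_rees: "subcring rees (UP R)"
proof -
  interpret UP: cring "UP R" by (rule UP_cring.UP_cring) (simp add: UP_cring_def is_cring)
  note up = subsetD[OF rees_subset_up]
  have car: "rees \<subseteq> carrier (UP R)" using rees_subset_up by (simp add: UP_def)
  have inv: "\<ominus>\<^bsub>UP R\<^esub> p = (\<lambda>i. \<zero> \<ominus> p i)" if "p \<in> rees" for p
  proof (rule UP.minus_equality)
    have m: "(\<lambda>i. \<zero> \<ominus> p i) \<in> rees" using rees_minus[OF rees_zero that] .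
    show "(\<lambda>i. \<zero> \<ominus> p i) \<oplus>\<^bsub>UP R\<^esub> p = \<zero>\<^bsub>UP R\<^esub>"
      using up[OF m] up[OF that] rees_carrier[OF that] by (auto simp: UP_def a_minus_def l_neg)
    show "p \<in> carrier (UP R)" "(\<lambda>i. \<zero> \<ominus> p i) \<in> carrier (UP R)" using car that m by auto
  qed
  have "subring rees (UP R)"
  proof (rule UP.subringI[OF car])
    show "\<one>\<^bsub>UP R\<^esub> \<in> rees" using rees_one by (simp add: UP_def single_def)
    show "\<ominus>\<^bsub>UP R\<^esub> p \<in> rees" if "p \<in> rees" for p using that inv rees_minus[OF rees_zero] by simp
    show "p \<otimes>\<^bsub>UP R\<^esub> q \<in> rees" if "p \<in> rees" "q \<in> rees" for p q
      using that up rees_conv by (simp add: UP_def conv_def)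
    show "p \<oplus>\<^bsub>UP R\<^esub> q \<in> rees" if "p \<in> rees" "q \<in> rees" for p q
      using that up rees_add by (simp add: UP_def)
  qed
  then show ?thesis by (rule UP.subcringI')
qed

lemma coset_eq_iff:
  "ideal J R \<Longrightarrow> x \<in> carrier R \<Longrightarrow> y \<in> carrier R \<Longrightarrow> J +> x = J +> y \<longleftrightarrow> x \<ominus> y \<in> J"
  using quotient_eq_iff_same_a_r_cos by blast

lemma coset_zero: "ideal J R \<Longrightarrow> J +> \<zero> = J"
  using a_rcos_zero ideal_zero by blast

lemma gr_class_eq_iff:
  assumes "p \<in> rees" "q \<in> rees"
  shows "gr_class p = gr_class q \<longleftrightarrow> (\<forall>i. p i \<ominus> q i \<in> Ip (Suc i))"
  using coset_eq_iff[OF Ip_ideal] rees_carrier[OF assms(1)] rees_carrier[OF assms(2)]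
  by (simp add: gr_class_def fun_eq_iff)

lemma carrier_gr: "carrier G = gr_class ` rees"
proof
  show "carrier G \<subseteq> gr_class ` rees"
  proof
    fix f assume "f \<in> carrier G"
    then have "\<forall>i. \<exists>a\<in>Ip i. f i = Ip (Suc i) +> a" by (simp add: assoc_graded_def gr_carrier_def)
    then obtain p where "\<And>i. p i \<in> Ip i \<and> f i = Ip (Suc i) +> p i" by metis
    then show "f \<in> gr_class ` rees" by (intro image_eqI[of _ _ p]) (auto simp: gr_class_def rees_def)
  qed
  show "gr_class ` rees \<subseteq> carrier G"
  proof clarify
    fix p assume p: "p \<in> rees"
    have "{i. gr_class p i \<noteq> Ip (Suc i)} \<subseteq> {..r}"
      using rees_eq_zero[OF p] coset_zero[OF Ip_ideal] by (force simp: gr_class_def)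
    then have "finite {i. gr_class p i \<noteq> Ip (Suc i)}" by (rule finite_subset) simp
    moreover have "\<exists>a\<in>Ip i. gr_class p i = Ip (Suc i) +> a" for i
      using rees_D[OF p] by (auto simp: gr_class_def)
    ultimately show "gr_class p \<in> carrier G" by (simp add: assoc_graded_def gr_carrier_def)
  qed
qed

text \<open>Of the choice made by \<open>gr_rep\<close> only this congruence modulo
  \<open>I\<^sup>i\<^sup>+\<^sup>1\<close> is used later; it suffices to compute sums and products
  with \<open>p\<close> itself.\<close>

lemma gr_rep_gr_class:
  assumes "p \<in> rees"
  shows "gr_rep R I i (gr_class p i) \<in> Ip i" "gr_rep R I i (gr_class p i) \<ominus> p i \<in> Ip (Suc i)"
proof -
  let ?a = "gr_rep R I i (gr_class p i)"
  have *: "?a \<in> Ip i \<and> gr_class p i = Ip (Suc i) +> ?a"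
    unfolding gr_rep_def by (rule someI_ex) (use rees_D[OF assms] in \<open>auto simp: gr_class_def\<close>)
  then show "?a \<in> Ip i" by blast
  have "Ip (Suc i) +> ?a = Ip (Suc i) +> p i" using * by (simp add: gr_class_def)
  then show "?a \<ominus> p i \<in> Ip (Suc i)"
    using coset_eq_iff[OF Ip_ideal] * Ip_carrier rees_carrier[OF assms] by blast
qed

lemma gr_zero: "\<zero>\<^bsub>G\<^esub> = gr_class (\<lambda>_. \<zero>)"
  by (simp add: assoc_graded_def gr_zero_def gr_class_def coset_zero[OF Ip_ideal])

lemma gr_one: "\<one>\<^bsub>G\<^esub> = gr_class (single \<one> 0)"
  by (simp add: assoc_graded_def gr_one_def gr_class_def single_def coset_zero[OF Ip_ideal] fun_eq_iff)

lemma gr_class_eq_zero_iff: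
  "p \<in> rees \<Longrightarrow> gr_class p = \<zero>\<^bsub>G\<^esub> \<longleftrightarrow> (\<forall>i. p i \<in> Ip (Suc i))"
  using gr_class_eq_iff[OF _ rees_zero] rees_carrier by (simp add: gr_zero a_minus_def)

lemma gr_add:
  assumes p: "p \<in> rees" and q: "q \<in> rees"
  shows "gr_class p \<oplus>\<^bsub>G\<^esub> gr_class q = gr_class (\<lambda>i. p i \<oplus> q i)"
proof
  fix k
  let ?a = "gr_rep R I k (gr_class p k)" and ?b = "gr_rep R I k (gr_class q k)"
  have c: "?a \<in> carrier R" "?b \<in> carrier R" "p k \<in> carrier R" "q k \<in> carrier R"
    using gr_rep_gr_class(1)[OF p] gr_rep_gr_class(1)[OF q] Ip_carrier rees_carrier p q by blast+
  have "(?a \<oplus> ?b) \<ominus> (p k \<oplus> q k) = (?a \<ominus> p k) \<oplus> (?b \<ominus> q k)" using c by algebra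
  then have "(?a \<oplus> ?b) \<ominus> (p k \<oplus> q k) \<in> Ip (Suc k)"
    using ideal_add[OF Ip_ideal] gr_rep_gr_class(2)[OF p] gr_rep_gr_class(2)[OF q] by simp
  then have "Ip (Suc k) +> (?a \<oplus> ?b) = Ip (Suc k) +> (p k \<oplus> q k)"
    using coset_eq_iff[OF Ip_ideal] c by simp
  then show "(gr_class p \<oplus>\<^bsub>G\<^esub> gr_class q) k = gr_class (\<lambda>i. p i \<oplus> q i) k"
    by (simp add: assoc_graded_def gr_add_def) (simp add: gr_class_def)
qed

text \<open>Independence of representatives: \<open>a b - p q = (a - p) b + p (b - q)\<close>, and
  each summand gains one power of \<open>I\<close> beyond its degree \<open>k\<close>.\<close>

lemma gr_mult:
  assumes p: "p \<in> rees" and q: "q \<in> rees"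
  shows "gr_class p \<otimes>\<^bsub>G\<^esub> gr_class q = gr_class (conv p q)"
proof
  fix k
  define a where "a i = gr_rep R I i (gr_class p i)" for i
  define b where "b i = gr_rep R I i (gr_class q i)" for i
  have a: "a i \<in> Ip i" "a i \<ominus> p i \<in> Ip (Suc i)" and b: "b i \<in> Ip i" "b i \<ominus> q i \<in> Ip (Suc i)" for i
    unfolding a_def b_def using gr_rep_gr_class p q by auto
  have ra: "a \<in> rees" and rb: "b \<in> rees" using a b by (auto simp: rees_def)
  have "a i \<otimes> b (k - i) \<ominus> p i \<otimes> q (k - i) \<in> Ip (Suc k)" if "i \<le> k" for i
  proof -
    have c: "a i \<in> carrier R" "b (k - i) \<in> carrier R" "p i \<in> carrier R" "q (k - i) \<in> carrier R"
      using rees_carrier ra rb p q by auto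
    have "a i \<otimes> b (k - i) \<ominus> p i \<otimes> q (k - i)
        = (a i \<ominus> p i) \<otimes> b (k - i) \<oplus> p i \<otimes> (b (k - i) \<ominus> q (k - i))" using c by algebra
    moreover have "(a i \<ominus> p i) \<otimes> b (k - i) \<in> Ip (Suc k)"
      using Ip_mult[OF a(2)[of i] b(1)[of "k - i"]] that by simp
    moreover have "p i \<otimes> (b (k - i) \<ominus> q (k - i)) \<in> Ip (Suc k)"
      using Ip_mult[OF rees_D[OF p, of i] b(2)[of "k - i"]] that by simp
    ultimately show ?thesis using ideal_add[OF Ip_ideal] by simp
  qed
  then have "conv a b k \<ominus> conv p q k \<in> Ip (Suc k)"
    unfolding conv_def using rees_carrier[OF ra] rees_carrier[OF rb] rees_carrier[OF p] rees_carrier[OF q]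
    by (subst finsum_minus) (auto intro!: ideal_finsum_closed[OF Ip_ideal])
  then have "Ip (Suc k) +> conv a b k = Ip (Suc k) +> conv p q k"
    using coset_eq_iff[OF Ip_ideal] rees_carrier[OF rees_conv] ra rb p q by simp
  then show "(gr_class p \<otimes>\<^bsub>G\<^esub> gr_class q) k = gr_class (conv p q) k"
    by (simp add: assoc_graded_def gr_mult_def a_def b_def conv_def) (simp add: gr_class_def)
qed

text \<open>Membership in \<open>ring_hom\<close> only asks that the operations be respected, so it
  can be shown before \<open>G\<close> is known to be a ring; the image of the subring
  \<open>rees\<close> then inherits the ring axioms. Commutativity is carried over
  separately.\<close>

lemma cring_gr: "cring G"
proof -
  let ?A = "(UP R)\<lparr>carrier := rees\<rparr>"
  interpret UP: cring "UP R" by (rule UP_cring.UP_cring) (simp add: UP_cring_def is_cring)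
  note up = subsetD[OF rees_subset_up]
  interpret A: cring ?A using UP.subcring_iff[of rees] subcring_rees rees_subset_up by (simp add: UP_def)
  have "gr_class \<in> ring_hom ?A G"
    by (rule ring_hom_memI)
      (use up carrier_gr gr_add gr_mult gr_one in \<open>auto simp: UP_def conv_def single_def\<close>)
  then have "ring (G\<lparr>carrier := gr_class ` carrier ?A, zero := gr_class \<zero>\<^bsub>?A\<^esub>\<rparr>)"
    by (rule A.ring_hom_imp_img_ring)
  moreover have "gr_class \<zero>\<^bsub>?A\<^esub> = \<zero>\<^bsub>G\<^esub>" by (simp add: UP_def gr_zero)
  ultimately have "ring G" using carrier_gr by (simp add: assoc_graded_def)
  then interpret G: ring G .
  have "x \<otimes>\<^bsub>G\<^esub> y = y \<otimes>\<^bsub>G\<^esub> x" if xy: "x \<in> carrier G" "y \<in> carrier G" for x y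
  proof -
    obtain p q where pq: "p \<in> rees" "q \<in> rees" "x = gr_class p" "y = gr_class q"
      using xy carrier_gr by auto
    have "p \<otimes>\<^bsub>?A\<^esub> q = q \<otimes>\<^bsub>?A\<^esub> p" using A.m_comm[of p q] pq by simp
    then have "conv p q = conv q p" using pq up by (simp add: UP_def conv_def)
    then show ?thesis using gr_mult pq by simp
  qed
  then show ?thesis using G.ring_axioms G.monoid_axioms
    by (auto simp: cring_def intro!: comm_monoid.intro comm_monoid_axioms.intro)
qed

sublocale G: cring G by (rule cring_gr)

lemma gr_class_closed: "p \<in> rees \<Longrightarrow> gr_class p \<in> carrier G"
  using carrier_gr by blast

lemma conv_single:
  assumes p: "p \<in> rees" and b: "b \<in> carrier R"
  shows "conv p (single b j) = (\<lambda>n. if j \<le> n then p (n - j) \<otimes> b else \<zero>)"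
proof
  fix n
  note c = rees_carrier[OF p]
  have "conv p (single b j) n = (\<Oplus>i\<in>{..n}. if n = i + j then p i \<otimes> b else \<zero>)"
    unfolding conv_def by (rule finsum_cong') (use c b in \<open>auto simp: single_def\<close>)
  also have "\<dots> = (if j \<le> n then p (n - j) \<otimes> b else \<zero>)"
  proof (cases "j \<le> n")
    case True
    have "(\<Oplus>i\<in>{..n}. if n = i + j then p i \<otimes> b else \<zero>) = (\<Oplus>i\<in>{..n}. if n - j = i then p i \<otimes> b else \<zero>)"
      by (rule finsum_cong') (use True c b in auto)
    also have "\<dots> = p (n - j) \<otimes> b" by (rule finsum_singleton) (use c b in auto)
    finally show ?thesis using True by simp
  next
    case False
    then have "(\<Oplus>i\<in>{..n}. if n = i + j then p i \<otimes> b else \<zero>) = (\<Oplus>i\<in>{..n}. \<zero>)"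
      by (intro finsum_cong') auto
    then show ?thesis using False by simp
  qed
  finally show "conv p (single b j) n = (if j \<le> n then p (n - j) \<otimes> b else \<zero>)" .
qed

end

section \<open>Maximal ideal and primes of the graded ring\<close>

context nilpotent_ideal
begin

lemma gr_mult_single:
  assumes "p \<in> rees" "b \<in> Ip j"
  shows "gr_class p \<otimes>\<^bsub>G\<^esub> gr_class (single b j) = gr_class (\<lambda>n. if j \<le> n then p (n - j) \<otimes> b else \<zero>)"
  using gr_mult[OF assms(1) rees_single[OF assms(2)]] conv_single[OF assms(1) Ip_carrier[OF assms(2)]]
  by simp

lemma rees_shift:
  assumes "p \<in> rees" "b \<in> Ip j" shows "(\<lambda>n. if j \<le> n then p (n - j) \<otimes> b else \<zero>) \<in> rees"
  using rees_conv[OF assms(1) rees_single[OF assms(2)]] conv_single[OF assms(1) Ip_carrier[OF assms(2)]]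
  by simp

lemma conv_0: "p \<in> rees \<Longrightarrow> q \<in> rees \<Longrightarrow> conv p q 0 = p 0 \<otimes> q 0"
  using rees_carrier by (simp add: conv_def)

lemma I_mem_max_ideal: "x \<in> Ip (Suc i) \<Longrightarrow> x \<in> \<mm>"
  using Ip_antimono[of "Suc 0" "Suc i"] Ip_Suc_0 I_subset by auto

text \<open>This is \<open>\<mm> / I\<close> in degree zero together with everything in positive
  degree. By \<open>I_subset\<close> the condition on \<open>p 0\<close> does not depend on the
  representative.\<close>

definition gr_max :: "(nat \<Rightarrow> 'a set) set" where
  "gr_max = {gr_class p | p. p \<in> rees \<and> p 0 \<in> \<mm>}"

lemma gr_class_mem_gr_max:
  assumes p: "p \<in> rees" shows "gr_class p \<in> gr_max \<longleftrightarrow> p 0 \<in> \<mm>"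
proof
  assume "gr_class p \<in> gr_max"
  then obtain q where q: "q \<in> rees" "q 0 \<in> \<mm>" "gr_class p = gr_class q" by (auto simp: gr_max_def)
  then have "p 0 \<ominus> q 0 \<in> Ip (Suc 0)" using gr_class_eq_iff p by blast
  then have "(p 0 \<ominus> q 0) \<oplus> q 0 \<in> \<mm>"
    using I_mem_max_ideal q ideal_add[OF ideal_max_ideal] by blast
  moreover have "(p 0 \<ominus> q 0) \<oplus> q 0 = p 0"
    using rees_carrier p q by (simp add: a_minus_def a_assoc l_neg)
  ultimately show "p 0 \<in> \<mm>" by simp
qed (use p in \<open>auto simp: gr_max_def\<close>)

lemma gr_max_ideal: "ideal gr_max G"
proof (rule G.idealI')
  show "gr_max \<subseteq> carrier G" by (auto simp: gr_max_def gr_class_closed)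
  show "\<zero>\<^bsub>G\<^esub> \<in> gr_max"
    using gr_class_mem_gr_max[OF rees_zero] ideal_zero[OF ideal_max_ideal] by (simp add: gr_zero)
  fix x assume "x \<in> gr_max"
  then obtain p where p: "p \<in> rees" "p 0 \<in> \<mm>" "x = gr_class p" by (auto simp: gr_max_def)
  show "x \<oplus>\<^bsub>G\<^esub> y \<in> gr_max" if y: "y \<in> gr_max" for y
  proof -
    obtain q where q: "q \<in> rees" "q 0 \<in> \<mm>" "y = gr_class q" using y by (auto simp: gr_max_def)
    show ?thesis
      using p q gr_add gr_class_mem_gr_max[OF rees_add] ideal_add[OF ideal_max_ideal] by simp
  qed
  show "x \<otimes>\<^bsub>G\<^esub> y \<in> gr_max" if y: "y \<in> carrier G" for y
  proof -
    obtain q where q: "q \<in> rees" "y = gr_class q" using y carrier_gr by auto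
    show ?thesis
      using p q gr_mult gr_class_mem_gr_max[OF rees_conv] conv_0 rees_carrier
        ideal.I_r_closed[OF ideal_max_ideal] by simp
  qed
qed

lemma gr_max_maximal: "maximalideal gr_max G"
proof (rule maximalidealI[OF gr_max_ideal])
  have "\<one>\<^bsub>G\<^esub> \<notin> gr_max"
    using gr_class_mem_gr_max[OF rees_one] one_notin_max_ideal by (simp add: gr_one single_def)
  then show "carrier G \<noteq> gr_max" by auto
  fix J assume J: "ideal J G" "gr_max \<subseteq> J" "J \<subseteq> carrier G"
  show "J = gr_max \<or> J = carrier G"
  proof (rule disjCI)
    assume "J \<noteq> carrier G"
    have "x \<in> gr_max" if x: "x \<in> J" for x
    proof (rule ccontr)
      assume no: "x \<notin> gr_max"
      obtain p where p: "p \<in> rees" "x = gr_class p" using x J carrier_gr by blast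
      then have "p 0 \<notin> \<mm>" using no gr_class_mem_gr_max by blast
      then obtain b where b: "b \<in> carrier R" "b \<otimes> p 0 = \<one>"
        using unit_if_notin_max_ideal rees_carrier p by blast
      have b0: "b \<in> Ip 0" using b by simp
      \<comment> \<open>Scaling by the inverse of \<open>p 0\<close> makes the constant term one, so
        \<open>1 - q\<close> lies in \<open>gr_max\<close>, hence in \<open>J\<close>, and then so
        does \<open>1 = (1 - q) + q\<close>.\<close>
      define q where "q = (\<lambda>n. p n \<otimes> b)"
      have q: "q \<in> rees" using rees_shift[OF p(1) b0] by (simp add: q_def)
      have qJ: "gr_class q \<in> J"
        using gr_mult_single[OF p(1) b0] ideal.I_r_closed[OF J(1) x gr_class_closed[OF rees_single[OF b0]]] p
        by (simp add: q_def)
      have s: "(\<lambda>i. single \<one> 0 i \<ominus> q i) \<in> rees" using rees_minus[OF rees_one q] .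
      have "single \<one> 0 0 \<ominus> q 0 = \<zero>"
        using b rees_carrier[OF p(1), of 0] by (simp add: q_def single_def m_comm a_minus_def r_neg)
      then have "gr_class (\<lambda>i. single \<one> 0 i \<ominus> q i) \<in> gr_max"
        using gr_class_mem_gr_max[OF s] ideal_zero[OF ideal_max_ideal] by simp
      then have "gr_class (\<lambda>i. single \<one> 0 i \<ominus> q i) \<oplus>\<^bsub>G\<^esub> gr_class q \<in> J"
        using G.ideal_add[OF J(1)] J(2) qJ by blast
      moreover have "(single \<one> 0 i \<ominus> q i) \<oplus> q i = single \<one> 0 i" for i
        using rees_carrier[OF rees_one] rees_carrier[OF q] by (simp add: a_minus_def a_assoc l_neg)
      ultimately have "\<one>\<^bsub>G\<^esub> \<in> J" using gr_add[OF s q] gr_one by simp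
      then show False using ideal.one_imp_carrier[OF J(1)] \<open>J \<noteq> carrier G\<close> by blast
    qed
    then show "J = gr_max" using J by blast
  qed
qed

text \<open>An element is the finite sum of its components in degrees up to \<open>r\<close>; the
  truncations \<open>t k\<close> are the partial sums.\<close>

lemma gr_class_trunc_mem:
  assumes J: "ideal J G" and p: "p \<in> rees" and s: "\<And>i. gr_class (single (p i) i) \<in> J"
  shows "gr_class p \<in> J"
proof -
  define t where "t k = (\<lambda>i. if i < k then p i else \<zero>)" for k :: nat
  have t: "t k \<in> rees" for k using rees_D[OF p] Ip_zero by (auto simp: t_def rees_def)
  have "gr_class (t k) \<in> J" for k
  proof (induction k)
    case 0
    then show ?case using G.ideal_zero[OF J] by (simp add: t_def gr_zero)
  next
    case (Suc k)
    have "t (Suc k) = (\<lambda>i. t k i \<oplus> single (p k) k i)"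
      using rees_carrier[OF p] by (auto simp: t_def single_def less_Suc_eq fun_eq_iff)
    then show ?case
      using gr_add[OF t rees_single[OF rees_D[OF p]]] G.ideal_add[OF J Suc s] by simp
  qed
  moreover have "t (Suc r) = p" using rees_eq_zero[OF p] by (auto simp: t_def fun_eq_iff)
  ultimately show ?thesis by metis
qed

lemma gr_class_single_mult:
  assumes "a \<in> Ip i" "b \<in> Ip j"
  shows "gr_class (single a i) \<otimes>\<^bsub>G\<^esub> gr_class (single b j) = gr_class (single (a \<otimes> b) (i + j))"
proof -
  have "(\<lambda>n. if j \<le> n then single a i (n - j) \<otimes> b else \<zero>) = single (a \<otimes> b) (i + j)"
    using Ip_carrier[OF assms(2)] by (auto simp: single_def fun_eq_iff)
  then show ?thesis using gr_mult_single[OF rees_single[OF assms(1)] assms(2)] by simp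
qed

text \<open>Homogeneous elements of positive degree are nilpotent; the degree-0 part of a prime
  pulls back to a prime of \<open>R\<close>.\<close>
lemma gr_prime_eq_gr_max:
  assumes P: "primeideal P G" shows "P = gr_max"
proof -
  interpret P: primeideal P G by fact
  have pos: "gr_class (single a i) \<in> P" if "a \<in> Ip i" "0 < i" for a i
    using that
  proof (induction "Suc r - i" arbitrary: a i rule: less_induct)
    case less
    show ?case
    proof (cases "r < i")
      case True
      then have "single a i = (\<lambda>_. \<zero>)" using less Ip_eq_zero by (auto simp: single_def)
      then show ?thesis using gr_zero P.zero_closed by simp
    next
      case False
      \<comment> \<open>Squaring doubles the degree and so moves towards the degrees above
        \<open>r\<close>, where everything vanishes; primality of \<open>P\<close> then undoes the
        square.\<close>
      have "gr_class (single (a \<otimes> a) (i + i)) \<in> P"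
        by (rule less.hyps) (use less.prems False Ip_mult in auto)
      then show ?thesis
        using P.I_prime gr_class_single_mult less.prems gr_class_closed rees_single by metis
    qed
  qed
  define Q where "Q = {a \<in> carrier R. gr_class (single a 0) \<in> P}"
  have mult: "gr_class (single (a \<otimes> b) 0) = gr_class (single a 0) \<otimes>\<^bsub>G\<^esub> gr_class (single b 0)"
    if "a \<in> carrier R" "b \<in> carrier R" for a b
    using gr_class_single_mult[of a 0 b 0] that by simp
  have cl: "gr_class (single a 0) \<in> carrier G" if "a \<in> carrier R" for a
    using gr_class_closed rees_single[of a 0] that by simp
  have "ideal Q R"
  proof (rule idealI')
    have "single \<zero> 0 = (\<lambda>_. \<zero>)" by (auto simp: single_def)
    then show "\<zero> \<in> Q" using gr_zero P.zero_closed by (simp add: Q_def)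
    show "x \<oplus> y \<in> Q" if "x \<in> Q" "y \<in> Q" for x y
    proof -
      have "single (x \<oplus> y) 0 = (\<lambda>i. single x 0 i \<oplus> single y 0 i)" by (auto simp: single_def)
      moreover have "gr_class (single x 0) \<oplus>\<^bsub>G\<^esub> gr_class (single y 0) \<in> P"
        using that P.a_closed by (simp add: Q_def)
      ultimately show ?thesis using that gr_add[of "single x 0" "single y 0"] rees_single[of _ 0]
        by (simp add: Q_def)
    qed
    show "x \<otimes> a \<in> Q" if "x \<in> Q" "a \<in> carrier R" for x a
      using that mult cl P.I_r_closed by (simp add: Q_def)
  qed (auto simp: Q_def)
  then have "primeideal Q R"
  proof (rule primeidealI[OF _ is_cring])
    have "\<one>\<^bsub>G\<^esub> \<notin> P" using P.one_imp_carrier P.I_notcarr by blast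
    then show "carrier R \<noteq> Q" by (auto simp: Q_def gr_one)
    show "a \<in> Q \<or> b \<in> Q" if "a \<in> carrier R" "b \<in> carrier R" "a \<otimes> b \<in> Q" for a b
      using P.I_prime[of "gr_class (single a 0)" "gr_class (single b 0)"] that mult cl by (auto simp: Q_def)
  qed
  then have Q: "Q = \<mm>" by (rule primeideal_eq_max_ideal)
  have "gr_max \<subseteq> P"
  proof
    fix x assume "x \<in> gr_max"
    then obtain p where p: "p \<in> rees" "p 0 \<in> \<mm>" "x = gr_class p" by (auto simp: gr_max_def)
    have "gr_class (single (p i) i) \<in> P" for i
      using pos[OF rees_D[OF p(1)], of i] p(2) Q by (cases "i = 0") (auto simp: Q_def)
    then show "x \<in> P" using gr_class_trunc_mem[OF P.ideal_axioms p(1)] p by simp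
  qed
  then show ?thesis
    using maximalideal.I_maximal[OF gr_max_maximal P.ideal_axioms] P.I_notcarr P.a_subset by blast
qed

text \<open>The initial coefficients in degree \<open>i\<close>: every element of \<open>J\<close> whose components below \<open>i\<close> vanish
  has a representative that is literally zero below \<open>i\<close>.\<close>
definition lead :: "(nat \<Rightarrow> 'a set) set \<Rightarrow> nat \<Rightarrow> 'a set" where
  "lead J i = {p i | p. p \<in> rees \<and> gr_class p \<in> J \<and> (\<forall>j<i. p j = \<zero>)}"

lemma lead_ideal:
  assumes J: "ideal J G" shows "ideal (lead J i) R"
proof (rule idealI')
  show "lead J i \<subseteq> carrier R" by (auto simp: lead_def rees_carrier)
  show "\<zero> \<in> lead J i" unfolding lead_def
    using rees_zero gr_zero G.ideal_zero[OF J] by (intro CollectI exI[of _ "\<lambda>_. \<zero>"]) simp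
  fix x assume "x \<in> lead J i"
  then obtain p where p: "p \<in> rees" "gr_class p \<in> J" "\<forall>j<i. p j = \<zero>" "x = p i" by (auto simp: lead_def)
  show "x \<oplus> y \<in> lead J i" if y: "y \<in> lead J i" for y
  proof -
    obtain q where q: "q \<in> rees" "gr_class q \<in> J" "\<forall>j<i. q j = \<zero>" "y = q i"
      using y by (auto simp: lead_def)
    then show ?thesis unfolding lead_def
      using p rees_add gr_add[of p q] G.ideal_add[OF J, of "gr_class p" "gr_class q"]
      by (intro CollectI exI[of _ "\<lambda>i. p i \<oplus> q i"]) simp
  qed
  show "x \<otimes> a \<in> lead J i" if a: "a \<in> carrier R" for a
  proof -
    have a0: "a \<in> Ip 0" using a by simp
    have "gr_class (\<lambda>n. p n \<otimes> a) \<in> J"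
      using gr_mult_single[OF p(1) a0] ideal.I_r_closed[OF J p(2) gr_class_closed[OF rees_single[OF a0]]]
      by simp
    then show ?thesis unfolding lead_def
      using p a rees_shift[OF p(1) a0] by (intro CollectI exI[of _ "\<lambda>n. p n \<otimes> a"]) simp
  qed
qed

lemma lead_mono: "J \<subseteq> K \<Longrightarrow> lead J i \<subseteq> lead K i"
  by (auto simp: lead_def)

text \<open>Subtracting from an element of \<open>K\<close> an element of \<open>J\<close> with the
  same first coefficient raises its order by one, and beyond degree \<open>r\<close> nothing is
  left. The induction counts the degrees that remain.\<close>

lemma subset_if_lead_subset:
  assumes J: "ideal J G" and K: "ideal K G" and JK: "J \<subseteq> K" and lead: "\<And>i. i \<le> r \<Longrightarrow> lead K i \<subseteq> lead J i"
  shows "K \<subseteq> J"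
proof -
  have mem: "gr_class p \<in> J" if "p \<in> rees" "gr_class p \<in> K" "\<forall>j<i. p j = \<zero>" for p i
    using that
  proof (induction "Suc r - i" arbitrary: p i)
    case 0
    then have "p j = \<zero>" for j using rees_eq_zero[of p j] by (cases "j < i") auto
    then have "p = (\<lambda>_. \<zero>)" by auto
    then show ?case using G.ideal_zero[OF J] gr_zero by simp
  next
    case (Suc d)
    then have "p i \<in> lead K i" by (auto simp: lead_def)
    moreover have "i \<le> r" using Suc.hyps(2) by simp
    ultimately have "p i \<in> lead J i" using lead by blast
    then obtain q where q: "q \<in> rees" "gr_class q \<in> J" "\<forall>j<i. q j = \<zero>" "q i = p i"
      unfolding lead_def by auto
    have d: "(\<lambda>i. p i \<ominus> q i) \<in> rees" using rees_minus Suc q by blast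
    have pq: "gr_class (\<lambda>i. p i \<ominus> q i) \<oplus>\<^bsub>G\<^esub> gr_class q = gr_class p"
    proof -
      have "(p i \<ominus> q i) \<oplus> q i = p i" for i
        using rees_carrier Suc(3) q(1) by (simp add: a_minus_def a_assoc l_neg)
      then show ?thesis using gr_add[OF d q(1)] by simp
    qed
    have "gr_class (\<lambda>i. p i \<ominus> q i) \<in> K"
      using G.ideal_mem_add_iff[OF K gr_class_closed[OF d], of "gr_class q"] pq Suc q JK by auto
    moreover have "\<forall>j<Suc i. p j \<ominus> q j = \<zero>"
      using Suc(5) q rees_carrier[OF Suc(3)] by (auto simp: less_Suc_eq a_minus_def r_neg)
    ultimately have "gr_class (\<lambda>i. p i \<ominus> q i) \<in> J"
      using Suc.hyps(1)[of "Suc i" "\<lambda>i. p i \<ominus> q i"] Suc.hyps(2) d by simp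
    then show ?case using G.ideal_add[OF J _ q(2)] pq by metis
  qed
  show ?thesis
  proof
    fix x assume x: "x \<in> K"
    then obtain p where "p \<in> rees" "x = gr_class p" using G.ideal_subset[OF K] carrier_gr by blast
    then show "x \<in> J" using mem[of p 0] x by simp
  qed
qed

text \<open>The total length of the leading ideals is bounded and strictly increasing in the
  ideal, so every chain of ideals has a largest member.\<close>
lemma gr_noetherian: "noetherian_ring G"
proof (rule G.trivial_ideal_chain_imp_noetherian)
  fix C assume ne: "C \<noteq> {}" and C: "subset.chain {J. ideal J G} C"
  define w where "w J = (\<Sum>i\<le>r. len (lead J i))" for J
  have iC: "ideal J G" if "J \<in> C" for J using C that by (auto simp: pred_on.chain_def)
  have len_le: "len (lead J i) \<le> len (lead K i)" if "J \<in> C" "K \<in> C" "J \<subseteq> K" for J K i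
    using len_mono lead_ideal lead_mono iC that by blast
  have bound: "w J \<le> (\<Sum>i\<le>r. len (carrier R))" if "J \<in> C" for J
    unfolding w_def using len_mono[OF lead_ideal[OF iC[OF that]] oneideal]
      ideal_subset[OF lead_ideal[OF iC[OF that]]] by (intro sum_mono) blast
  then obtain J where J: "J \<in> C" "\<forall>K\<in>C. w K \<le> w J"
    using ex_has_greatest_nat[of "\<lambda>J. J \<in> C" _ w "Suc (\<Sum>i\<le>r. len (carrier R))"] ne bound
    by (metis ex_in_conv less_Suc_eq_le)
  have "K \<subseteq> J" if K: "K \<in> C" for K
  proof (rule ccontr)
    assume no: "\<not> K \<subseteq> J"
    have "J \<subset> K \<or> J = K \<or> K \<subset> J" using C J(1) K unfolding pred_on.chain_def by auto
    with no have JK: "J \<subseteq> K" by blast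
    have "\<not> (\<forall>i\<le>r. lead K i \<subseteq> lead J i)"
      using no subset_if_lead_subset[OF iC[OF J(1)] iC[OF K] JK] by blast
    then obtain i where i: "i \<le> r" "\<not> lead K i \<subseteq> lead J i" by blast
    have "lead J i \<subset> lead K i" using i(2) lead_mono[OF JK, of i] by blast
    then have "len (lead J i) < len (lead K i)"
      using len_strict_mono lead_ideal iC J K by blast
    then have "w J < w K" unfolding w_def using i(1) len_le[OF J(1) K JK]
      by (intro sum_strict_mono_ex1) auto
    then show False using J K by fastforce
  qed
  then have "\<Union>C = J" using J by blast
  then show "\<Union>C \<in> C" using J by simp
qed

lemma zero_dim_local_gr: "zero_dim_local_ring G"
  unfolding zero_dim_local_ring_def local_cring_def
proof (intro conjI)
  show "\<exists>!M. maximalideal M G"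
    using gr_max_maximal G.maximalideal_prime gr_prime_eq_gr_max by blast
  show "\<forall>P. primeideal P G \<longrightarrow> maximalideal P G"
    using gr_prime_eq_gr_max gr_max_maximal by blast
qed (use gr_noetherian G.is_cring in auto)

sublocale G: zero_dim_local G
  by unfold_locales (rule zero_dim_local_gr)

section \<open>The socle of the graded ring, degree by degree\<close>

lemma max_ideal_gr: "max_ideal G = gr_max"
  using gr_prime_eq_gr_max G.maximalideal_prime[OF G.maximalideal_max_ideal] by blast

text \<open>\<open>gr_max\<close> is homogeneous and contains every proper ideal, so it is the
  unique solution of the definite description. Thus the graded socle of the theorem is the ordinary
  socle of \<open>G\<close>.\<close>

lemma gr_max_homog_eq: "gr_max_homog R I = gr_max"
proof -
  have "gr_comp R I x i \<in> gr_max" if x: "x \<in> gr_max" for x i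
  proof -
    obtain p where p: "p \<in> rees" "p 0 \<in> \<mm>" "x = gr_class p" using x by (auto simp: gr_max_def)
    have "gr_comp R I x i = gr_class (single (p i) i)"
      using coset_zero[OF Ip_ideal] by (auto simp: gr_comp_def gr_class_def single_def p(3) fun_eq_iff)
    moreover have "single (p i) i 0 \<in> \<mm>" using p ideal_zero[OF ideal_max_ideal] by (simp add: single_def)
    ultimately show ?thesis using gr_class_mem_gr_max[OF rees_single[OF rees_D[OF p(1)]]] by simp
  qed
  then have h: "homogeneous_ideal R I gr_max" using gr_max_ideal by (simp add: homogeneous_ideal_def)
  have p: "gr_max \<noteq> carrier G" using maximalideal.I_notcarr[OF gr_max_maximal] by blast
  have le: "J \<subseteq> gr_max" if "homogeneous_ideal R I J" "J \<noteq> carrier G" for J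
    using G.proper_ideal_subset_max_ideal that max_ideal_gr by (simp add: homogeneous_ideal_def)
  show ?thesis unfolding gr_max_homog_def
  proof (rule the_equality)
    show "homogeneous_ideal R I gr_max \<and> gr_max \<noteq> carrier G \<and>
      (\<forall>J'. homogeneous_ideal R I J' \<and> J' \<noteq> carrier G \<and> gr_max \<subseteq> J' \<longrightarrow> J' = gr_max)"
      using h p le by blast
  qed (use h p le in blast)
qed

lemma socle_gr: "socle G = gr_socle R I"
  by (simp add: socle_def gr_socle_def max_ideal_gr gr_max_homog_eq)

text \<open>The class of \<open>a\<close> in degree \<open>i\<close> lies in the socle of \<open>G\<close>.\<close>
definition soc_coeff :: "nat \<Rightarrow> 'a \<Rightarrow> bool" where
  "soc_coeff i a \<longleftrightarrow> a \<in> Ip i \<and> (\<forall>b\<in>\<mm>. a \<otimes> b \<in> Ip (Suc i)) \<and>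
    (\<forall>j b. 0 < j \<longrightarrow> b \<in> Ip j \<longrightarrow> a \<otimes> b \<in> Ip (Suc (i + j)))"

text \<open>Multipliers \<open>single b j\<close> only shift and scale \<open>p\<close>, so
  vanishing of the product can be read off degree by degree. Conversely, each term of the
  convolution with an element of \<open>gr_max\<close> gains a power of \<open>I\<close>.\<close>

lemma gr_class_mem_socle:
  assumes p: "p \<in> rees" shows "gr_class p \<in> socle G \<longleftrightarrow> (\<forall>i. soc_coeff i (p i))"
proof
  assume s: "gr_class p \<in> socle G"
  \<comment> \<open>The condition \<open>single b j 0 \<in> \<mm>\<close> means
    \<open>b \<in> \<mm>\<close> for \<open>j = 0\<close> and is automatic for \<open>j > 0\<close>,
    so both clauses of \<open>soc_coeff\<close> come out of one statement.\<close>
  have prod: "p i \<otimes> b \<in> Ip (Suc (i + j))" if b: "b \<in> Ip j" "single b j 0 \<in> \<mm>" for i j b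
  proof -
    have "gr_class (single b j) \<in> max_ideal G"
      using gr_class_mem_gr_max[OF rees_single] b max_ideal_gr by simp
    then have "gr_class (\<lambda>n. if j \<le> n then p (n - j) \<otimes> b else \<zero>) = \<zero>\<^bsub>G\<^esub>"
      using s gr_mult_single[OF p b(1)] by (simp add: socle_def)
    then have "(if j \<le> i + j then p (i + j - j) \<otimes> b else \<zero>) \<in> Ip (Suc (i + j))"
      using gr_class_eq_zero_iff[OF rees_shift[OF p b(1)]] by blast
    then show ?thesis by simp
  qed
  show "\<forall>i. soc_coeff i (p i)"
    unfolding soc_coeff_def
    using prod[where j = 0] prod rees_D[OF p] ideal_zero[OF ideal_max_ideal] max_ideal_subset
    by (simp add: single_def)
next
  assume s: "\<forall>i. soc_coeff i (p i)"
  have "gr_class p \<otimes>\<^bsub>G\<^esub> y = \<zero>\<^bsub>G\<^esub>" if "y \<in> gr_max" for y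
  proof -
    obtain q where q: "q \<in> rees" "q 0 \<in> \<mm>" "y = gr_class q" using \<open>y \<in> gr_max\<close> by (auto simp: gr_max_def)
    have "p i \<otimes> q (k - i) \<in> Ip (Suc k)" if "i \<le> k" for i k
    proof (cases "i = k")
      case True then show ?thesis using s q by (simp add: soc_coeff_def)
    next
      case False
      then have "0 < k - i" using that by simp
      then have "p i \<otimes> q (k - i) \<in> Ip (Suc (i + (k - i)))"
        using s rees_D[OF q(1)] unfolding soc_coeff_def by blast
      then show ?thesis using that by simp
    qed
    then have "conv p q k \<in> Ip (Suc k)" for k
      unfolding conv_def by (intro ideal_finsum_closed[OF Ip_ideal]) auto
    then show ?thesis using gr_class_eq_zero_iff[OF rees_conv[OF p q(1)]] gr_mult p q by simp
  qed
  then show "gr_class p \<in> socle G" using gr_class_closed[OF p] by (simp add: socle_def max_ideal_gr)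
qed

lemma soc_coeff_zero: "soc_coeff i \<zero>"
  using max_ideal_subset Ip_carrier Ip_zero by (simp add: soc_coeff_def)

lemma single_mem_socle:
  "soc_coeff i a \<Longrightarrow> single a i \<in> rees \<and> gr_class (single a i) \<in> socle G"
  using gr_class_mem_socle[OF rees_single, of a i] rees_single[of a i] soc_coeff_zero
  by (simp add: single_def) (simp add: soc_coeff_def)

lemma gr_socle_deg_eq_zero_iff:
  "gr_socle_deg R I i = {\<zero>\<^bsub>G\<^esub>} \<longleftrightarrow> (\<forall>a. soc_coeff i a \<longrightarrow> a \<in> Ip (Suc i))"
proof (intro iffI allI impI)
  fix a assume h: "gr_socle_deg R I i = {\<zero>\<^bsub>G\<^esub>}" and a: "soc_coeff i a"
  have "gr_class (single a i) j = Ip (Suc j)" if "j \<noteq> i" for j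
    using that coset_zero[OF Ip_ideal] by (simp add: gr_class_def single_def)
  then have "gr_class (single a i) \<in> gr_socle_deg R I i"
    using single_mem_socle[OF a] socle_gr by (simp add: gr_socle_deg_def)
  then have "\<forall>j. single a i j \<in> Ip (Suc j)"
    using h gr_class_eq_zero_iff single_mem_socle[OF a] by auto
  then show "a \<in> Ip (Suc i)" by (metis single_def)
next
  assume h: "\<forall>a. soc_coeff i a \<longrightarrow> a \<in> Ip (Suc i)"
  have "f = \<zero>\<^bsub>G\<^esub>" if f: "f \<in> gr_socle_deg R I i" for f
  proof -
    have fs: "f \<in> socle G" "\<forall>j. j \<noteq> i \<longrightarrow> f j = Ip (Suc j)"
      using f by (auto simp: gr_socle_deg_def socle_gr)
    then obtain p where p: "p \<in> rees" "f = gr_class p" using carrier_gr by (auto simp: socle_def)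
    have "p j \<in> Ip (Suc j)" for j
    proof (cases "j = i")
      case True then show ?thesis using h gr_class_mem_socle[OF p(1)] fs p by blast
    next
      case False
      then have "Ip (Suc j) +> p j = Ip (Suc j)" using fs p by (simp add: gr_class_def)
      then show ?thesis using ideal.rcos_const_imp_mem[OF Ip_ideal rees_carrier[OF p(1)]] by blast
    qed
    then show ?thesis using gr_class_eq_zero_iff p by blast
  qed
  moreover have "\<zero>\<^bsub>G\<^esub> \<in> gr_socle_deg R I i"
    using gr_class_mem_socle[OF rees_zero] soc_coeff_zero
    by (simp add: gr_socle_deg_def socle_gr[symmetric] gr_zero gr_class_def coset_zero[OF Ip_ideal])
  ultimately show "gr_socle_deg R I i = {\<zero>\<^bsub>G\<^esub>}" by blast
qed

end

section \<open>The socle of the associated graded ring\<close>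

lemma (in ring) ideal_mem_cong:
  assumes J: "ideal J R" and c: "x \<in> carrier R" "y \<in> carrier R" and "x \<ominus> y \<in> J"
  shows "x \<in> J \<longleftrightarrow> y \<in> J"
proof -
  have "x = y \<oplus> (x \<ominus> y)" using c by (simp add: a_minus_def a_lcomm r_neg)
  then show ?thesis using ideal_mem_add_iff[OF J c(2) assms(4)] by metis
qed

context gorenstein_nilpotent
begin

text \<open>Some multiple \<open>d = c a\<close> outside \<open>I\<^sup>i\<^sup>+\<^sup>1\<close> is
  sent into it by \<open>\<mm>\<close>. Since \<open>d\<close> is no socle coefficient, a
  \<open>b\<close> of positive degree \<open>j\<close> keeps it nonzero in degree
  \<open>i + j\<close>, and the induction goes on from there until degree \<open>r\<close>.\<close>

lemma ex_mult_nonzero: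
  assumes soc: "\<forall>i<r. \<forall>a. soc_coeff i a \<longrightarrow> a \<in> Ip (Suc i)"
    and "i \<le> r" "a \<in> Ip i" "a \<notin> Ip (Suc i)"
  shows "\<exists>b\<in>Ip (r - i). a \<otimes> b \<noteq> \<zero>"
  using assms(2-4)
proof (induction "r - i" arbitrary: i a rule: less_induct)
  case less
  have aR: "a \<in> carrier R" using Ip_carrier less by blast
  show ?case
  proof (cases "i = r")
    case True
    then have "a \<noteq> \<zero>" using less Ip_zero by blast
    then show ?thesis using True aR by (intro bexI[of _ \<one>]) auto
  next
    case False
    let ?N = "Ip (Suc i)"
    have N: "ideal ?N R" by (rule Ip_ideal)
    have "\<not> ?N <+> PIdl a \<subseteq> ?N" using subset_add_cgenideal[OF N aR] less by blast
    then obtain x where x: "x \<in> ?N <+> PIdl a" "x \<notin> ?N" "\<forall>y\<in>\<mm>. x \<otimes> y \<in> ?N"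
      using ex_socle_mod[OF N add_cgenideal_ideal[OF N aR]] by blast
    obtain n c where nc: "n \<in> ?N" "c \<in> carrier R" "x = n \<oplus> c \<otimes> a"
      using x(1) by (auto simp: mem_add_cgenideal)
    have nR: "n \<in> carrier R" using nc Ip_carrier by blast
    define d where "d = c \<otimes> a"
    have d: "d \<in> Ip i" using ideal.I_l_closed[OF Ip_ideal less(3) nc(2)] by (simp add: d_def)
    then have dR: "d \<in> carrier R" using Ip_carrier by blast
    have dN: "d \<notin> ?N" using x(2) nc ideal_add[OF N] by (auto simp: d_def)
    have dm: "d \<otimes> y \<in> ?N" if y: "y \<in> \<mm>" for y
    proof -
      have yR: "y \<in> carrier R" using y max_ideal_subset by blast
      have "d \<otimes> y \<oplus> n \<otimes> y = x \<otimes> y" using nc(3) dR nR yR by (simp add: d_def l_distr a_comm)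
      then show ?thesis
        using ideal_mem_add_iff[OF N, of "d \<otimes> y" "n \<otimes> y"] ideal.I_r_closed[OF N nc(1) yR] x y dR yR by simp
    qed
    have "i < r" using less(2) False by simp
    then have "\<not> soc_coeff i d" using soc dN by blast
    \<comment> \<open>As \<open>\<mm>\<close> already sends \<open>d\<close> into \<open>?N\<close>,
      only the clause of \<open>soc_coeff\<close> with \<open>0 < j\<close> can fail.\<close>
    then obtain j b where jb: "0 < j" "b \<in> Ip j" "d \<otimes> b \<notin> Ip (Suc (i + j))"
      unfolding soc_coeff_def using d dm by blast
    have db: "d \<otimes> b \<in> Ip (i + j)" using Ip_mult d jb by blast
    have ij: "i + j \<le> r"
    proof (rule ccontr)
      assume "\<not> i + j \<le> r"
      then have "d \<otimes> b = \<zero>" using Ip_eq_zero[of "i + j"] db by simp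
      then show False using jb Ip_zero by simp
    qed
    have "r - (i + j) < r - i" using jb(1) \<open>i < r\<close> by arith
    then obtain e where e: "e \<in> Ip (r - (i + j))" "d \<otimes> b \<otimes> e \<noteq> \<zero>"
      using less.hyps[of "i + j" "d \<otimes> b"] jb(3) db ij by blast
    have bR: "b \<in> carrier R" and eR: "e \<in> carrier R" using Ip_carrier jb e by auto
    have "b \<otimes> e \<in> Ip (r - i)" using Ip_mult[OF jb(2) e(1)] ij by simp
    then have "c \<otimes> (b \<otimes> e) \<in> Ip (r - i)" using ideal.I_l_closed[OF Ip_ideal] nc by blast
    moreover have "a \<otimes> (c \<otimes> (b \<otimes> e)) = d \<otimes> b \<otimes> e" using nc(2) aR bR eR by (simp add: d_def m_ac)
    ultimately show ?thesis using e by metis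
  qed
qed

text \<open>A socle coefficient of degree \<open>i\<close> times
  \<open>I\<^sup>r\<^sup>-\<^sup>i\<close> falls into \<open>I\<^sup>r\<^sup>+\<^sup>1 = 0\<close>.
  Conversely, an element annihilating \<open>I\<^sup>r\<^sup>-\<^sup>i\<close> climbs through the
  powers of \<open>I\<close>: were it stuck at some \<open>k \<le> i\<close>,
  \<open>ex_mult_nonzero\<close> would give a multiplier in \<open>I\<^sup>r\<^sup>-\<^sup>k
  \<subseteq> I\<^sup>r\<^sup>-\<^sup>i\<close> that does not kill it.\<close>

lemma ann_iff_soc:
  "(\<forall>i<r. ann (Ip (r - i)) = Ip (Suc i)) \<longleftrightarrow> (\<forall>i<r. \<forall>a. soc_coeff i a \<longrightarrow> a \<in> Ip (Suc i))"
proof (intro iffI allI impI)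
  fix i a assume A: "\<forall>i<r. ann (Ip (r - i)) = Ip (Suc i)" and i: "i < r" and a: "soc_coeff i a"
  have "a \<otimes> b = \<zero>" if "b \<in> Ip (r - i)" for b
    using a[unfolded soc_coeff_def] that i Ip_eq_zero[of "Suc (i + (r - i))"]
    by (metis le_add_diff_inverse less_imp_le lessI singletonD zero_less_diff)
  then have "a \<in> ann (Ip (r - i))" using a Ip_carrier by (auto simp: colon_def soc_coeff_def)
  then show "a \<in> Ip (Suc i)" using A i by blast
next
  fix i assume soc: "\<forall>i<r. \<forall>a. soc_coeff i a \<longrightarrow> a \<in> Ip (Suc i)" and i: "i < r"
  have "ann (Ip (r - i)) \<subseteq> Ip (Suc i)"
  proof
    fix x assume x: "x \<in> ann (Ip (r - i))"
    have "x \<in> Ip k" if "k \<le> Suc i" for k using that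
    proof (induction k)
      case 0 then show ?case using x by (simp add: colon_def)
    next
      case (Suc k)
      have xk: "x \<in> Ip k" using Suc by simp
      show ?case
      proof (rule ccontr)
        assume "x \<notin> Ip (Suc k)"
        then obtain b where b: "b \<in> Ip (r - k)" "x \<otimes> b \<noteq> \<zero>"
          using ex_mult_nonzero[OF soc, of k x] xk Suc i by auto
        then have "b \<in> Ip (r - i)" using Ip_antimono[OF diff_le_mono2, of k i r] Suc.prems by auto
        then show False using x b by (simp add: colon_def)
      qed
    qed
    then show "x \<in> Ip (Suc i)" by simp
  qed
  moreover have "Ip (Suc i) \<subseteq> ann (Ip (r - i))" by (rule Ip_subset_ann) (use i in simp)
  ultimately show "ann (Ip (r - i)) = Ip (Suc i)" by blast
qed

text \<open>The positive-degree part of \<open>q\<close> lies in the maximal ideal and kills the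
  socle, so \<open>G\<close> acts on its socle through constant terms alone.\<close>

lemma socle_scalar:
  assumes p: "p \<in> rees" "gr_class p \<in> socle G" and q: "q \<in> rees"
  shows "gr_class q \<otimes>\<^bsub>G\<^esub> gr_class p = gr_class (\<lambda>n. p n \<otimes> q 0)"
proof -
  have q0: "q 0 \<in> Ip 0" using rees_D q by blast
  define q' where "q' i = (if i = 0 then \<zero> else q i)" for i
  have q': "q' \<in> rees" using rees_D[OF q] Ip_zero by (auto simp: rees_def q'_def)
  have s: "single (q 0) 0 \<in> rees" using rees_single q0 .
  have "(\<lambda>i. q' i \<oplus> single (q 0) 0 i) = q" using rees_carrier[OF q] by (auto simp: q'_def single_def)
  then have "gr_class q = gr_class q' \<oplus>\<^bsub>G\<^esub> gr_class (single (q 0) 0)" using gr_add[OF q' s] by simp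
  moreover have "gr_class q' \<in> max_ideal G"
    using gr_class_mem_gr_max[OF q'] ideal_zero[OF ideal_max_ideal] max_ideal_gr by (simp add: q'_def)
  then have "gr_class p \<otimes>\<^bsub>G\<^esub> gr_class q' = \<zero>\<^bsub>G\<^esub>" using p by (simp add: socle_def)
  ultimately have "gr_class p \<otimes>\<^bsub>G\<^esub> gr_class q = gr_class p \<otimes>\<^bsub>G\<^esub> gr_class (single (q 0) 0)"
    using gr_class_closed p q' s by (simp add: G.r_distr)
  then show ?thesis
    using gr_mult_single[OF p(1) q0] G.m_comm gr_class_closed p q by simp
qed

lemma gorenstein_gr_iff:
  "gorenstein_zero_dim G \<longleftrightarrow> (\<forall>i<r. \<forall>a. soc_coeff i a \<longrightarrow> a \<in> Ip (Suc i))"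
proof -
  obtain z where z: "z \<in> socle R" "z \<noteq> \<zero>" by (rule ex_socle_nonzero)
  have zr: "z \<in> Ip r" using socle_subset_nonzero_ideal[OF Ip_ideal I_r] z by blast
  have "z \<otimes> b = \<zero>" if "b \<in> \<mm>" for b using z that by (simp add: socle_def)
  moreover have "b \<in> \<mm>" if "b \<in> Ip j" "0 < j" for b j
    using that I_mem_max_ideal[of b "j - 1"] by simp
  ultimately have "soc_coeff r z" using zr Ip_zero by (simp add: soc_coeff_def)
  then have t: "single z r \<in> rees" "gr_class (single z r) \<in> socle G" using single_mem_socle by auto
  let ?t = "gr_class (single z r)"
  have "z \<notin> Ip (Suc r)" using z I_Suc by simp
  then have t0: "?t \<noteq> \<zero>\<^bsub>G\<^esub>" using gr_class_eq_zero_iff[OF t(1)] by (metis single_def)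
  have ex_p: "\<exists>p\<in>rees. x = gr_class p" if "x \<in> carrier G" for x using that carrier_gr by auto
  show ?thesis
  proof (intro iffI allI impI)
    fix i a assume g: "gorenstein_zero_dim G" and i: "i < r" and a: "soc_coeff i a"
    obtain s where s: "s \<in> carrier G" "socle G = {x \<otimes>\<^bsub>G\<^esub> s | x. x \<in> carrier G}"
      using g by (auto simp: gorenstein_zero_dim_def)
    obtain p where p: "p \<in> rees" "s = gr_class p" using ex_p s by blast
    have "\<one>\<^bsub>G\<^esub> \<otimes>\<^bsub>G\<^esub> s \<in> socle G" unfolding s(2) by blast
    then have ps: "gr_class p \<in> socle G" using s p by simp
    have soc_p: "soc_coeff i (p i)" for i using gr_class_mem_socle[OF p(1)] ps by blast
    have rep: "\<exists>q\<in>rees. \<forall>i. f i \<ominus> p i \<otimes> q 0 \<in> Ip (Suc i)"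
      if f: "f \<in> rees" "gr_class f \<in> socle G" for f
    proof -
      have "\<exists>x\<in>carrier G. gr_class f = x \<otimes>\<^bsub>G\<^esub> s" using f(2) unfolding s(2) by blast
      then obtain q where q: "q \<in> rees" "gr_class f = gr_class q \<otimes>\<^bsub>G\<^esub> s" using ex_p by metis
      then have "gr_class f = gr_class (\<lambda>n. p n \<otimes> q 0)" using socle_scalar[OF p(1) ps] p by simp
      moreover have "(\<lambda>n. p n \<otimes> q 0) \<in> rees"
        using rees_shift[OF p(1) rees_D[OF q(1), of 0]] by simp
      ultimately show ?thesis using gr_class_eq_iff f(1) q(1) by blast
    qed
    \<comment> \<open>Degree \<open>r\<close> will show that the scalar \<open>q 0\<close> is a
      unit: \<open>z\<close> is nonzero there, whereas \<open>\<mm>\<close> kills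
      \<open>p r\<close>. In degree \<open>i < r\<close> the element \<open>single z r\<close>
      vanishes, which then forces the generator's own component \<open>p i\<close> into
      \<open>Ip (Suc i)\<close>.\<close>
    obtain q where q: "q \<in> rees" "\<forall>i. single z r i \<ominus> p i \<otimes> q 0 \<in> Ip (Suc i)" using rep t by blast
    have c: "p i \<in> carrier R" "q i \<in> carrier R" for i using rees_carrier p q by auto
    have mem: "single z r i \<in> Ip (Suc i) \<longleftrightarrow> p i \<otimes> q 0 \<in> Ip (Suc i)" for i
      using ideal_mem_cong[OF Ip_ideal] q(2) rees_carrier[OF t(1)] c by simp
    have "q 0 \<notin> \<mm>"
    proof
      assume "q 0 \<in> \<mm>"
      then have "p r \<otimes> q 0 \<in> Ip (Suc r)" using soc_p by (simp add: soc_coeff_def)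
      then show False using mem[of r] \<open>z \<notin> Ip (Suc r)\<close> by (simp add: single_def)
    qed
    then obtain e where e: "e \<in> carrier R" "e \<otimes> q 0 = \<one>" using unit_if_notin_max_ideal c by blast
    have "p i \<otimes> q 0 \<in> Ip (Suc i)" using mem[of i] i Ip_zero by (simp add: single_def)
    then have "p i \<otimes> q 0 \<otimes> e \<in> Ip (Suc i)" using ideal.I_r_closed[OF Ip_ideal] e by blast
    moreover have "p i \<otimes> q 0 \<otimes> e = p i" using c e by (simp add: m_assoc m_comm[of "q 0" e])
    ultimately have pi: "p i \<in> Ip (Suc i)" by simp
    \<comment> \<open>The class of \<open>a\<close> is a scalar multiple of the generator, whose
      component in degree \<open>i\<close> has just been shown to vanish.\<close>
    obtain q' where q': "q' \<in> rees" "\<forall>j. single a i j \<ominus> p j \<otimes> q' 0 \<in> Ip (Suc j)"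
      using rep single_mem_socle[OF a] by blast
    have "a \<ominus> p i \<otimes> q' 0 \<in> Ip (Suc i)" using q'(2)[rule_format, of i] by (simp add: single_def)
    moreover have "p i \<otimes> q' 0 \<in> Ip (Suc i)"
      using ideal.I_r_closed[OF Ip_ideal pi] rees_carrier[OF q'(1)] by blast
    moreover have "a \<in> carrier R" using a Ip_carrier by (auto simp: soc_coeff_def)
    ultimately show "a \<in> Ip (Suc i)"
      using ideal_mem_cong[OF Ip_ideal, of a "p i \<otimes> q' 0"] c rees_carrier[OF q'(1)] by simp
  next
    assume soc: "\<forall>i<r. \<forall>a. soc_coeff i a \<longrightarrow> a \<in> Ip (Suc i)"
    have "socle G = {x \<otimes>\<^bsub>G\<^esub> ?t | x. x \<in> carrier G}"
    proof (intro equalityI subsetI)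
      fix f assume f: "f \<in> socle G"
      then obtain p where p: "p \<in> rees" "f = gr_class p" using ex_p by (auto simp: socle_def)
      have sp: "soc_coeff i (p i)" for i using gr_class_mem_socle[OF p(1)] f p by blast
      \<comment> \<open>In degree \<open>r\<close> the target \<open>Ip (Suc r)\<close> is zero, so
        \<open>\<mm>\<close> kills \<open>p r\<close>, which therefore lies on the line spanned by
        \<open>z\<close>.\<close>
      have "p r \<in> socle R" using sp[of r] I_Suc rees_carrier[OF p(1)] by (simp add: soc_coeff_def socle_def)
      then obtain u where u: "u \<in> carrier R" "p r = u \<otimes> z" using socle_multiple z by blast
      have tp: "single (p r) r \<in> rees" using rees_single rees_D p by blast
      have "p i \<ominus> single (p r) r i \<in> Ip (Suc i)" for i
      proof (cases i r rule: linorder_cases)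
        case less
        then show ?thesis using soc sp rees_carrier[OF p(1)] by (simp add: single_def a_minus_def)
      next
        case equal
        then show ?thesis using rees_carrier[OF p(1)] Ip_zero by (simp add: single_def a_minus_def r_neg)
      next
        case greater
        then show ?thesis using rees_eq_zero[OF p(1)] Ip_zero by (simp add: single_def a_minus_def)
      qed
      then have "f = gr_class (single (p r) r)" using gr_class_eq_iff[OF p(1) tp] p by blast
      also have "\<dots> = gr_class (single u 0) \<otimes>\<^bsub>G\<^esub> ?t"
        using gr_class_single_mult[of u 0 z r] u zr by simp
      finally show "f \<in> {x \<otimes>\<^bsub>G\<^esub> ?t | x. x \<in> carrier G}"
        using gr_class_closed rees_single[of u 0] u by auto
    next
      fix f assume "f \<in> {x \<otimes>\<^bsub>G\<^esub> ?t | x. x \<in> carrier G}"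
      then obtain x where x: "x \<in> carrier G" "f = x \<otimes>\<^bsub>G\<^esub> ?t" by blast
      have "f \<otimes>\<^bsub>G\<^esub> y = \<zero>\<^bsub>G\<^esub>" if "y \<in> max_ideal G" for y
        using x t that G.max_ideal_subset by (simp add: socle_def G.m_assoc)
      then show "f \<in> socle G" using x t by (simp add: socle_def)
    qed
    moreover have "socle G \<noteq> {\<zero>\<^bsub>G\<^esub>}" using t t0 by blast
    ultimately show "gorenstein_zero_dim G"
      unfolding gorenstein_zero_dim_def using zero_dim_local_gr gr_class_closed[OF t(1)] by blast
  qed
qed

end

text \<open>For \<open>r = 0\<close> the floor is \<open>-1\<close> and no index qualifies. The form
  \<open>2 * i + 1 \<le> r\<close> respects this, whereas the natural number
  \<open>(r - 1) div 2\<close> would admit \<open>i = 0\<close>.\<close>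

lemma le_floor_half_iff: "int i \<le> \<lfloor>(real r - 1) / 2\<rfloor> \<longleftrightarrow> 2 * i + 1 \<le> r"
  by (simp add: le_floor_iff) linarith

lemma gorenstein_nilpotentI:
  fixes R :: "('a, 'b) ring_scheme" and I :: "'a set" and r :: nat
  assumes "gorenstein_zero_dim R"
    and "ideal I R" and "I \<subseteq> max_ideal R"
    and "ideal_pow R I r \<noteq> {\<zero>\<^bsub>R\<^esub>}" and "ideal_pow R I (Suc r) = {\<zero>\<^bsub>R\<^esub>}"
  shows "gorenstein_nilpotent R I r"
proof -
  have zdl: "zero_dim_local_ring R" using assms(1) by (simp add: gorenstein_zero_dim_def)
  then have c: "cring R" by (simp add: zero_dim_local_ring_def local_cring_def)
  then have z: "zero_dim_local R" using zdl by (simp add: zero_dim_local_def zero_dim_local_axioms_def)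
  show ?thesis using z c assms
    by (simp add: gorenstein_nilpotent_def gorenstein_nilpotent_axioms_def nilpotent_ideal_def
      nilpotent_ideal_axioms_def gorenstein_local_def gorenstein_local_axioms_def)
qed
theorem theorem3p1:
  fixes R :: "('a, 'b) ring_scheme" and I :: "'a set" and r :: nat
  assumes "gorenstein_zero_dim R"
    and "ideal I R" and "I \<subseteq> max_ideal R"
    and "ideal_pow R I r \<noteq> {\<zero>\<^bsub>R\<^esub>}" and "ideal_pow R I (Suc r) = {\<zero>\<^bsub>R\<^esub>}"
  defines "G \<equiv> assoc_graded R I"
  shows "let
      P1 = gorenstein_zero_dim G;
      P2 = (\<forall>i. i < r \<longrightarrow> gr_socle_deg R I i = {\<zero>\<^bsub>G\<^esub>});
      P3 = (\<forall>i. i < r \<longrightarrow> colon R {\<zero>\<^bsub>R\<^esub>} (ideal_pow R I (r - i)) = ideal_pow R I (i + 1));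
      P4 = (\<forall>i. int i \<le> \<lfloor>(real r - 1) / 2\<rfloor> \<longrightarrow>
              colon R {\<zero>\<^bsub>R\<^esub>} (ideal_pow R I (r - i)) = ideal_pow R I (i + 1));
      P5 = (\<forall>i. int i \<le> \<lfloor>(real r - 1) / 2\<rfloor> \<longrightarrow>
              quot_length R (ideal_pow R I i) (ideal_pow R I (i + 1))
              = quot_length R (ideal_pow R I (r - i)) (ideal_pow R I (r - i + 1)));
      P6 = ((\<forall>i. 1 \<le> i \<and> i < r \<longrightarrow> colon R (ideal_pow R I r) (ideal_pow R I (r - i)) = ideal_pow R I i)
            \<and> colon R {\<zero>\<^bsub>R\<^esub>} I = ideal_pow R I r);
      P7 = ((\<forall>i. 1 \<le> i \<and> i < r \<longrightarrow> faithful_over R (ideal_pow R I i) (ideal_pow R I (r - i)) (ideal_pow R I r))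
            \<and> faithful_over R (ideal_pow R I r) I {\<zero>\<^bsub>R\<^esub>})
    in (P1 \<longleftrightarrow> P2) \<and> (P1 \<longleftrightarrow> P3) \<and> (P1 \<longleftrightarrow> P4) \<and> (P1 \<longleftrightarrow> P5)
       \<and> (P1 \<longleftrightarrow> P6) \<and> (P1 \<longleftrightarrow> P7)"
proof -
  note gn = gorenstein_nilpotentI[OF assms(1-5)]
  then have n: "nilpotent_ideal R I r" by (simp add: gorenstein_nilpotent_def)
  show ?thesis
    \<comment> \<open>The rewriting turns (1) and (2) into the condition on \<open>soc_coeff\<close>
      and, by the reversed \<open>ann_iff_soc\<close>, into (3). What remains are the links from (3)
      through (4) to (5), and through (6) to (7).\<close>
    unfolding Let_def G_def le_floor_half_iff Suc_eq_plus1[symmetric]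
      gorenstein_nilpotent.gorenstein_gr_iff[OF gn] nilpotent_ideal.gr_socle_deg_eq_zero_iff[OF n]
      gorenstein_nilpotent.ann_iff_soc[OF gn, symmetric]
    using gorenstein_nilpotent.ann_half_iff[OF gn] gorenstein_nilpotent.ann_half_iff_length[OF gn]
      gorenstein_nilpotent.ann_iff_colon[OF gn] gorenstein_nilpotent.colon_iff_faithful[OF gn]
    by simp
qed

end
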